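(* Algorithm AC-ASO (described in the context) implements an atomic snapshot object: for each execution there is a sequence $\sigma$ of all SCAN and UPDATE operations in the execution that satisfies the real-time order and sequential specification properties.
   Context: Model: asynchronous message-passing system with $n$ nodes $1,\dots,n$, at most $f<n/2$ of which may crash; reliable FIFO channels between every pair of nodes (a message whose send command is completed is eventually delivered if the receiver has not crashed, and messages from $i$ to $j$ are delivered in sending order). Each node is sequential: it has at most one pending SCAN or UPDATE operation at any time. Local computation time is negligible. Atomic snapshot object: it has $n$ segments; node $i$ invokes UPDATE$(v)$ to write $v$ into segment $i$ (only $i$ writes segment $i$); SCAN returns a vector $Snap$ with one value per segment. It is atomic if for each execution there is a sequence $\sigma$ of all SCAN and UPDATE operations such that: (Real-time order) if $Op_1$ completes before $Op_2$ starts, $Op_1$ precedes $Op_2$ in $\sigma$; (Sequential specification) if a SCAN returns $Snap$, then for each $i$, $Snap[i]$ is the value written by the latest UPDATE of node $i$ preceding the SCAN in $\sigma$, or the initial value if there is none. Algorithm AC-ASO, at node $i$. Variables: vector of sets $V_i[1..n]$ (initially all empty), integer $maxTag_i$ (initially 0), vector of sets $D_i[1..n]$ (initially all empty). Elements of these sets are value-timestamp pairs $\langle v,\langle r,j\rangle\rangle$, where the integer $r$ is the tag and $j$ the writer. For a set $H$, $H^{\le r}$ is its subset of elements with tag at most $r$; $V^{\le r}=[V[1]^{\le r},\dots,V[n]^{\le r}]$. $\mathrm{EQ}(V,i)$ is true iff there is $Q\subseteq\{1,\dots,n\}$ with $|Q|\ge n-f$ and $V[j]=V[i]$ for all $j\in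 Q$. Procedures: - UPDATE$(v)$: $r\gets readTag()$; $ts\gets\langle r+1,i\rangle$; send ("value", $\langle v,ts\rangle$) to all; run $Lattice(r)$ (phase 0); $r'\gets\max\{r+1,maxTag_i\}$; run $LatticeRenewal(r')$; return ACK. - SCAN: $r\gets readTag()$; $S\gets LatticeRenewal(r)$; return $Snap$, where $Snap[j]$ is the value $v$ with $\langle v,\langle t',j\rangle\rangle\in S$ and $t'$ largest among $j$'s values in $S$. - $Lattice(r)$: run $writeTag(r)$; wait until $\mathrm{EQ}(V_i^{\le r},i)$ is true; then atomically, at the first moment it is true: let $V^*=V_i^{\le r}$; if $maxTag_i\le r$, send ("goodLA", $r$) to all and return $(true,V^*[i])$; else return $(false,\emptyset)$. - $LatticeRenewal(r)$: for phase $=1,2,3$: $(status,view)\gets Lattice(r)$; if $status=true$, return $view$; else if phase $=3$, leave the loop; otherwise set $r\gets maxTag_i$ and continue. After the loop, wait until ("goodLA", $r$) is received from some node $j$ and return $D_i[j]$. - $readTag()$: send ("readTag") to all, wait for at least $n-f$ ("readAck", $*$) messages, return the largest tag contained in them. - $writeTag(r)$: send ("writeTag", $r$) to all, wait for at least $n-f$ ("writeAck", $r$) messages. Message handlers (atomic, always running in the background): on ("value", $\langle u,ts\rangle$) from $j$: add $\langle u,ts\rangle$ to $V_i[j]$ and $V_i[i]$, and if it has not been seen before send ("value", $\langle u,ts\rangle$) to all. On ("writeTag", $r$) from $j$: $maxTag_i\gets\max\{maxTag_i,r\}$, send ("echoTag", $r$) to all, send ("writeAck", $r$) to $j$. On ("echoTag",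 $r$): $maxTag_i\gets\max\{maxTag_i,r\}$. On ("readTag") from $j$: send ("readAck", $maxTag_i$) to $j$. On ("goodLA", $r$) from $j$: $D_i[j]\gets V_i[j]^{\le r}$ (executed before any pending $LatticeRenewal$ waiting for this message returns). *)

theory Defs
  imports "HOL-Library.Cardinality" "HOL-Library.Extended_Nat"
begin

text \<open>
  Nodes are the elements of a finite type \<open>'n\<close>, so the number of nodes is \<open>CARD('n)\<close>.
  The set element \<open>(v, r, j)\<close> is the value \<open>v\<close> with timestamp \<open>(r, j)\<close>, that is, with
  tag \<open>r\<close> and writer \<open>j\<close>.
\<close>

type_synonym ('n, 'v) stamped = "'v \<times> nat \<times> 'n"

datatype 'v opn = Scan | Update 'v

datatype ('n, 'v) response = Ack | Snap "'n \<Rightarrow> 'v"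

text \<open>
  Requests and acknowledgements carry a request number (the first argument), by which a node
  counts only acknowledgements of the request it is currently waiting for. As channels are FIFO
  and every node answers every request, the number only makes explicit which request an
  acknowledgement answers. Left-over acknowledgements of an earlier request must not be counted.
\<close>

datatype ('n, 'v) msg =
    Value "('n, 'v) stamped"
  | ReadTag nat
  | ReadAck nat nat
  | WriteTag nat nat
  | WriteAck nat nat
  | EchoTag nat
  | GoodLA nat

text \<open>
  Control states of the sequential program of a node, all with the current operation. In
  \<open>WriteWait op p r\<close> and \<open>EqWait op p r\<close> the node executes \<open>Lattice(r)\<close> in phase \<open>p\<close>, waiting for
  the acknowledgements of \<open>writeTag(r)\<close> and for the equality predicate, respectively; phase 0 is
  the call made directly by UPDATE, phases 1, 2, 3 are those of \<open>LatticeRenewal\<close>.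
  In \<open>GoodWait op r\<close> it waits for a message \<open>GoodLA r\<close>.
\<close>

datatype 'v control =
    Idle
  | Start "'v opn"
  | ReadWait "'v opn"
  | WriteWait "'v opn" nat nat
  | EqWait "'v opn" nat nat
  | GoodWait "'v opn" nat

text \<open>
  Besides the variables \<open>V\<close>, \<open>maxTag\<close> and \<open>D\<close> of the algorithm, a node stores its control state,
  the number of its latest request, the acknowledgements of that request (sender and tag), and
  the \<open>GoodLA\<close> messages received so far (sender and tag).
\<close>

record ('n, 'v) node_state =
  V :: "'n \<Rightarrow> ('n, 'v) stamped set"
  maxTag :: nat
  D :: "'n \<Rightarrow> ('n, 'v) stamped set"
  ctrl :: "'v control"
  req :: nat
  acks :: "('n \<times> nat) set"
  goods :: "('n \<times> nat) set"

definition init_node :: "('n, 'v) node_state" where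
  "init_node = \<lparr>V = (\<lambda>_. {}), maxTag = 0, D = (\<lambda>_. {}), ctrl = Idle,
                req = 0, acks = {}, goods = {}\<rparr>"

definition tag_le :: "nat \<Rightarrow> ('n, 'v) stamped set \<Rightarrow> ('n, 'v) stamped set" where
  "tag_le r H = {(v, t, j). (v, t, j) \<in> H \<and> t \<le> r}"

definition EQ :: "nat \<Rightarrow> ('n::finite \<Rightarrow> ('n, 'v) stamped set) \<Rightarrow> 'n \<Rightarrow> bool" where
  "EQ f W i \<longleftrightarrow> (\<exists>Q. card Q \<ge> CARD('n) - f \<and> (\<forall>j\<in>Q. W j = W i))"

definition snapshot :: "('n \<Rightarrow> 'v) \<Rightarrow> ('n, 'v) stamped set \<Rightarrow> 'n \<Rightarrow> 'v" where
  "snapshot init S j =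
     (if \<exists>v t. (v, t, j) \<in> S
      then THE v. \<exists>t. (v, t, j) \<in> S \<and> (\<forall>v' t'. (v', t', j) \<in> S \<longrightarrow> t' \<le> t)
      else init j)"

fun respond :: "('n \<Rightarrow> 'v) \<Rightarrow> 'v opn \<Rightarrow> ('n, 'v) stamped set \<Rightarrow> ('n, 'v) response" where
  "respond init Scan S = Snap (snapshot init S)"
| "respond init (Update v) S = Ack"

text \<open>
  The messages sent in one step are a list of multicasts, in sending order: \<open>(A, m)\<close> sends \<open>m\<close>
  to all nodes in \<open>A\<close>.
\<close>

type_synonym ('n, 'v) sends = "('n set \<times> ('n, 'v) msg) list"

fun handle :: "'n \<Rightarrow> 'n \<Rightarrow> ('n, 'v) msg \<Rightarrow> ('n, 'v) node_state
    \<Rightarrow> ('n, 'v) node_state \<times> ('n, 'v) sends" where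
  "handle i j (Value x) s =
     (s\<lparr>V := (V s)(j := insert x (V s j), i := insert x (V s i))\<rparr>,
      if x \<in> V s i then [] else [(UNIV, Value x)])"
| "handle i j (ReadTag q) s = (s, [({j}, ReadAck q (maxTag s))])"
| "handle i j (ReadAck q r) s =
     (if q = req s then s\<lparr>acks := insert (j, r) (acks s)\<rparr> else s, [])"
| "handle i j (WriteTag q r) s =
     (s\<lparr>maxTag := max (maxTag s) r\<rparr>, [(UNIV, EchoTag r), ({j}, WriteAck q r)])"
| "handle i j (WriteAck q r) s =
     (if q = req s then s\<lparr>acks := insert (j, r) (acks s)\<rparr> else s, [])"
| "handle i j (EchoTag r) s = (s\<lparr>maxTag := max (maxTag s) r\<rparr>, [])"
| "handle i j (GoodLA r) s =
     (s\<lparr>D := (D s)(j := tag_le r (V s j)), goods := insert (j, r) (goods s)\<rparr>, [])"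

definition begin_lattice ::
    "'v opn \<Rightarrow> nat \<Rightarrow> nat \<Rightarrow> ('n, 'v) node_state \<Rightarrow> ('n, 'v) node_state" where
  "begin_lattice op p r s =
     s\<lparr>req := Suc (req s), acks := {}, ctrl := WriteWait op p r\<rparr>"

definition write_tag :: "nat \<Rightarrow> ('n, 'v) node_state \<Rightarrow> ('n, 'v) sends" where
  "write_tag r s = [(UNIV, WriteTag (Suc (req s)) r)]"

text \<open>
  \<open>advance f init i s s' outs res\<close>: the sequential program of node \<open>i\<close> moves from local state \<open>s\<close>
  to \<open>s'\<close>, sending \<open>outs\<close>; if \<open>res = Some x\<close>, the current operation then completes with
  response \<open>x\<close>.
\<close>

inductive advance :: "nat \<Rightarrow> ('n::finite \<Rightarrow> 'v) \<Rightarrow> 'n \<Rightarrow> ('n, 'v) node_state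
    \<Rightarrow> ('n, 'v) node_state \<Rightarrow> ('n, 'v) sends \<Rightarrow> ('n, 'v) response option \<Rightarrow> bool"
  for f :: nat and init :: "'n::finite \<Rightarrow> 'v" and i :: 'n and s :: "('n, 'v) node_state"
where
  read_tag:
    "ctrl s = Start op \<Longrightarrow>
     advance f init i s
       (s\<lparr>req := Suc (req s), acks := {}, ctrl := ReadWait op\<rparr>)
       [(UNIV, ReadTag (Suc (req s)))] None"
| update_read:
    "ctrl s = ReadWait (Update v) \<Longrightarrow> card (acks s) \<ge> CARD('n) - f \<Longrightarrow>
     r = Max (snd ` acks s) \<Longrightarrow>
     advance f init i s (begin_lattice (Update v) 0 r s)
       ((UNIV, Value (v, r + 1, i)) # write_tag r s) None"
| scan_read:
    "ctrl s = ReadWait Scan \<Longrightarrow> card (acks s) \<ge> CARD('n) - f \<Longrightarrow>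
     r = Max (snd ` acks s) \<Longrightarrow>
     advance f init i s (begin_lattice Scan 1 r s) (write_tag r s) None"
| written:
    "ctrl s = WriteWait op p r \<Longrightarrow> card (acks s) \<ge> CARD('n) - f \<Longrightarrow>
     advance f init i s (s\<lparr>ctrl := EqWait op p r\<rparr>) [] None"
| lattice_phase0:
    "ctrl s = EqWait op 0 r \<Longrightarrow> EQ f (\<lambda>j. tag_le r (V s j)) i \<Longrightarrow>
     r' = max (r + 1) (maxTag s) \<Longrightarrow>
     advance f init i s (begin_lattice op 1 r' s)
       ((if maxTag s \<le> r then [(UNIV, GoodLA r)] else []) @ write_tag r' s) None"
| lattice_good:
    "ctrl s = EqWait op p r \<Longrightarrow> p \<noteq> 0 \<Longrightarrow> EQ f (\<lambda>j. tag_le r (V s j)) i \<Longrightarrow>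
     maxTag s \<le> r \<Longrightarrow>
     advance f init i s (s\<lparr>ctrl := Idle\<rparr>) [(UNIV, GoodLA r)]
       (Some (respond init op (tag_le r (V s i))))"
| lattice_retry:
    "ctrl s = EqWait op p r \<Longrightarrow> p \<in> {1, 2} \<Longrightarrow> EQ f (\<lambda>j. tag_le r (V s j)) i \<Longrightarrow>
     \<not> maxTag s \<le> r \<Longrightarrow>
     advance f init i s (begin_lattice op (p + 1) (maxTag s) s) (write_tag (maxTag s) s) None"
| lattice_give_up:
    "ctrl s = EqWait op 3 r \<Longrightarrow> EQ f (\<lambda>j. tag_le r (V s j)) i \<Longrightarrow>
     \<not> maxTag s \<le> r \<Longrightarrow>
     advance f init i s (s\<lparr>ctrl := GoodWait op r\<rparr>) [] None"
| borrow:
    "ctrl s = GoodWait op r \<Longrightarrow> (j, r) \<in> goods s \<Longrightarrow>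
     advance f init i s (s\<lparr>ctrl := Idle\<rparr>) [] (Some (respond init op (D s j)))"

text \<open>\<open>chan C j i\<close> is the content of the channel from \<open>j\<close> to \<open>i\<close>, oldest message first.\<close>

record ('n, 'v) config =
  nodes :: "'n \<Rightarrow> ('n, 'v) node_state"
  chan :: "'n \<Rightarrow> 'n \<Rightarrow> ('n, 'v) msg list"
  crashed :: "'n set"

definition init_config :: "('n, 'v) config" where
  "init_config = \<lparr>nodes = (\<lambda>_. init_node), chan = (\<lambda>_ _. []), crashed = {}\<rparr>"

definition post :: "'n \<Rightarrow> ('n, 'v) sends \<Rightarrow> ('n \<Rightarrow> 'n \<Rightarrow> ('n, 'v) msg list)
    \<Rightarrow> 'n \<Rightarrow> 'n \<Rightarrow> ('n, 'v) msg list" where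
  "post i outs ch =
     ch(i := (\<lambda>k. ch i k @ map snd (filter (\<lambda>(A, m). k \<in> A) outs)))"

text \<open>
  A node that crashes while sending stops in the middle of the list, and possibly in the middle
  of a multicast, which then reaches only a subset of its destinations.
\<close>

definition interrupted :: "('n, 'v) sends \<Rightarrow> ('n, 'v) sends \<Rightarrow> bool" where
  "interrupted outs outs' \<longleftrightarrow>
     (\<exists>us A A' m vs. outs = us @ (A, m) # vs \<and> A' \<subseteq> A \<and> outs' = us @ [(A', m)])"

datatype ('n, 'v) event =
    Invoke 'n "'v opn"
  | Return 'n "('n, 'v) response"
  | Internal 'n
  | Deliver 'n 'n
  | Crash 'n

text \<open>
  \<open>node_step f init C i e s' ch outs\<close>: in configuration \<open>C\<close>, node \<open>i\<close> can do \<open>e\<close>, reaching local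
  state \<open>s'\<close> and sending \<open>outs\<close>, where \<open>ch\<close> are the channels before \<open>outs\<close> is sent.
  \<open>Deliver j i\<close> is delivery to \<open>i\<close> of the oldest message from \<open>j\<close>. It requires that the program
  of \<open>i\<close> is blocked: local computation is instantaneous compared to communication, and a
  waiting program continues at the first moment at which its condition holds.
\<close>

inductive node_step :: "nat \<Rightarrow> ('n::finite \<Rightarrow> 'v) \<Rightarrow> ('n, 'v) config \<Rightarrow> 'n \<Rightarrow> ('n, 'v) event
    \<Rightarrow> ('n, 'v) node_state \<Rightarrow> ('n \<Rightarrow> 'n \<Rightarrow> ('n, 'v) msg list) \<Rightarrow> ('n, 'v) sends \<Rightarrow> bool"
  for f :: nat and init :: "'n::finite \<Rightarrow> 'v" and C :: "('n, 'v) config" and i :: 'n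
where
  invoke:
    "ctrl (nodes C i) = Idle \<Longrightarrow>
     node_step f init C i (Invoke i op) ((nodes C i)\<lparr>ctrl := Start op\<rparr>) (chan C) []"
| internal:
    "advance f init i (nodes C i) s' outs None \<Longrightarrow>
     node_step f init C i (Internal i) s' (chan C) outs"
| return:
    "advance f init i (nodes C i) s' outs (Some x) \<Longrightarrow>
     node_step f init C i (Return i x) s' (chan C) outs"
| deliver:
    "chan C j i = m # ms \<Longrightarrow>
     (\<nexists>s'' outs'' res. advance f init i (nodes C i) s'' outs'' res) \<Longrightarrow>
     handle i j m (nodes C i) = (s', outs) \<Longrightarrow>
     node_step f init C i (Deliver j i) s' ((chan C)(j := (chan C j)(i := ms))) outs"

inductive step :: "nat \<Rightarrow> ('n::finite \<Rightarrow> 'v) \<Rightarrow> ('n, 'v) config \<Rightarrow> ('n, 'v) event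
    \<Rightarrow> ('n, 'v) config \<Rightarrow> bool"
  for f :: nat and init :: "'n::finite \<Rightarrow> 'v" and C :: "('n, 'v) config"
where
  normal:
    "i \<notin> crashed C \<Longrightarrow> node_step f init C i e s' ch outs \<Longrightarrow>
     step f init C e (C\<lparr>nodes := (nodes C)(i := s'), chan := post i outs ch\<rparr>)"
| crash:
    "i \<notin> crashed C \<Longrightarrow> card (insert i (crashed C)) \<le> f \<Longrightarrow>
     step f init C (Crash i) (C\<lparr>crashed := insert i (crashed C)\<rparr>)"
| crash_sending:
    "i \<notin> crashed C \<Longrightarrow> card (insert i (crashed C)) \<le> f \<Longrightarrow>
     node_step f init C i e s' ch outs \<Longrightarrow> interrupted outs outs' \<Longrightarrow>
     step f init C (Crash i)
       (C\<lparr>chan := post i outs' ch, crashed := insert i (crashed C)\<rparr>)"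

text \<open>
  An execution of length \<open>N\<close>, finite or infinite, passes through the configurations \<open>C k\<close> for
  \<open>k \<le> N\<close>; the event \<open>ev k\<close> with \<open>k < N\<close> leads from \<open>C k\<close> to \<open>C (Suc k)\<close>. A finite execution
  may stop anywhere. In an infinite one, every message sent to a node that never crashes is
  eventually delivered.
\<close>

definition execution :: "nat \<Rightarrow> ('n::finite \<Rightarrow> 'v) \<Rightarrow> enat \<Rightarrow> (nat \<Rightarrow> ('n, 'v) config)
    \<Rightarrow> (nat \<Rightarrow> ('n, 'v) event) \<Rightarrow> bool" where
  "execution f init N C ev \<longleftrightarrow>
     C 0 = init_config \<and>
     (\<forall>k. enat k < N \<longrightarrow> step f init (C k) (ev k) (C (Suc k))) \<and>
     (N = \<infinity> \<longrightarrow>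
       (\<forall>i j k. chan (C k) j i \<noteq> [] \<and> (\<forall>l. i \<notin> crashed (C l)) \<longrightarrow>
          (\<exists>l\<ge>k. ev l = Deliver j i)))"

text \<open>An operation is identified with the position of its invocation in the execution.\<close>

definition operations :: "enat \<Rightarrow> (nat \<Rightarrow> ('n, 'v) event) \<Rightarrow> nat set" where
  "operations N ev = {k. enat k < N \<and> (\<exists>i op. ev k = Invoke i op)}"

definition completes :: "enat \<Rightarrow> (nat \<Rightarrow> ('n, 'v) event) \<Rightarrow> nat \<Rightarrow> nat
    \<Rightarrow> ('n, 'v) response \<Rightarrow> bool" where
  "completes N ev a m x \<longleftrightarrow>
     a < m \<and> enat m < N \<and>
     (\<exists>i op. ev a = Invoke i op \<and> ev m = Return i x \<and>
        (\<forall>l. a < l \<and> l < m \<longrightarrow> (\<forall>y. ev l \<noteq> Return i y)))"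

text \<open>
  A sequence of all operations is a well-order \<open>\<sigma>\<close> on them (reflexive, as usual in the library);
  if there are finitely many operations, this is the same as a list of them without repetitions.
  In an infinite execution, real-time order leaves only finitely many operations before each
  completed one. Only pending operations (at most one per node) can come after infinitely many
  others. This cannot be excluded: an UPDATE whose node crashes before sending anything has no
  other place if other nodes keep completing SCAN operations forever.
\<close>

definition real_time_order :: "enat \<Rightarrow> (nat \<Rightarrow> ('n, 'v) event) \<Rightarrow> nat rel \<Rightarrow> bool" where
  "real_time_order N ev \<sigma> \<longleftrightarrow>
     (\<forall>a\<in>operations N ev. \<forall>b\<in>operations N ev.
        (\<exists>m x. completes N ev a m x \<and> m < b) \<longrightarrow> (a, b) \<in> \<sigma> \<and> a \<noteq> b)"

definition updates_before :: "enat \<Rightarrow> (nat \<Rightarrow> ('n, 'v) event) \<Rightarrow> nat rel \<Rightarrow> 'n \<Rightarrow> nat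
    \<Rightarrow> nat set" where
  "updates_before N ev \<sigma> i b =
     {a \<in> operations N ev. (\<exists>v. ev a = Invoke i (Update v)) \<and> (a, b) \<in> \<sigma> \<and> a \<noteq> b}"

definition sequential_spec :: "('n \<Rightarrow> 'v) \<Rightarrow> enat \<Rightarrow> (nat \<Rightarrow> ('n, 'v) event) \<Rightarrow> nat rel
    \<Rightarrow> bool" where
  "sequential_spec init N ev \<sigma> \<longleftrightarrow>
     (\<forall>b\<in>operations N ev. \<forall>j m x. ev b = Invoke j Scan \<and> completes N ev b m x \<longrightarrow>
        (\<exists>snp. x = Snap snp \<and>
          (\<forall>i. if updates_before N ev \<sigma> i b = {} then snp i = init i
               else \<exists>a\<in>updates_before N ev \<sigma> i b.
                      (\<forall>c\<in>updates_before N ev \<sigma> i b. (c, a) \<in> \<sigma>) \<and>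
                      ev a = Invoke i (Update (snp i)))))"

end

theory Submission
  imports Defs "HOL-Library.Sublist" "HOL-Library.Product_Lexorder"
begin

text \<open>
  Call a Lattice operation with tag \<open>r\<close> good at a moment when \<open>EQ\<close> holds for \<open>r\<close> and
  \<open>maxTag \<le> r\<close>; its view is the node's set of values with tag at most \<open>r\<close>. The views of good
  operations form a chain. For equal tags, the two quorums share a node \<open>j\<close>, and by FIFO both
  views consist of what a prefix of the values multicast by \<open>j\<close> contributes. For tags \<open>r < r'\<close>,
  some \<open>j\<close> in the quorum of the first operation acknowledged \<open>r'\<close> to the second one. Its echo of
  \<open>r'\<close> had not reached the first node, so \<open>j\<close> had forwarded the first view before it
  acknowledged \<open>r'\<close>.

  Every response is computed from the view of a good operation, possibly one of another node.
  It contains the views of all good operations that ended before the invocation, because their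
  tags had been written to a quorum, and it contains the value of the UPDATE itself. Hence
  ordering the SCANs by their views, and putting each UPDATE just before the first SCAN
  whose view contains its value, respects real time.
\<close>

section \<open>Executions with their history\<close>

text \<open>The delicate case is a borrowed view, whose lender may have been invoked before the
  borrower. What makes it recent is its tag. Every retry strictly increases the tag, so from phase 2
  on it exceeds all tags that a quorum had at the invocation, and of two good views the one with the
  larger tag contains the other, whatever their times. Phase 0 does the same for the UPDATE's own
  value: it forces the value into every good view with a tag above that of phase 1, which covers all
  tags from phase 2 on.

  For two UPDATEs in real-time order, the timestamp of the later one exceeds the tags of all views
  completed before its invocation. So a view that contains the later value has a larger tag than the
  view of the earlier UPDATE, and includes that view.

  Two features of the model need care. A crash may cut a multicast, so a value may be seen although
  its UPDATE got no further; and a node receives its own messages with delay, so its own set may lag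
  behind what it has multicast.\<close>

definition msgs :: "'n \<Rightarrow> ('n, 'v) sends \<Rightarrow> ('n, 'v) msg list" where
  "msgs l outs = map snd (filter (\<lambda>(A, m). l \<in> A) outs)"

definition vals :: "('n, 'v) msg list \<Rightarrow> ('n, 'v) stamped list" where
  "vals ms = [x. Value x \<leftarrow> ms]"

lemma msgs_simps [simp]:
  "msgs l [] = []"
  "msgs l ((A, m) # outs) = (if l \<in> A then m # msgs l outs else msgs l outs)"
  "msgs l (xs @ ys) = msgs l xs @ msgs l ys"
  by (auto simp: msgs_def)

lemma vals_append [simp]: "vals (xs @ ys) = vals xs @ vals ys"
  by (simp add: vals_def)

lemma vals_Nil [simp]: "vals [] = []"
  by (simp add: vals_def)

lemma vals_Cons [simp]: "vals (m # ms) = (case m of Value x \<Rightarrow> x # vals ms | _ \<Rightarrow> vals ms)"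
  by (simp add: vals_def split: msg.split)

lemma set_vals [simp]: "x \<in> set (vals ms) \<longleftrightarrow> Value x \<in> set ms"
  by (induction ms) (auto split: msg.splits)

lemma prefix_vals: "prefix xs ys \<Longrightarrow> prefix (vals xs) (vals ys)"
  by (auto simp: prefix_def)

lemma prefix_in_set: "prefix xs ys \<Longrightarrow> x \<in> set xs \<Longrightarrow> x \<in> set ys"
  by (auto simp: prefix_def)

lemma prefix_snocD: "prefix (xs @ [x]) ys \<Longrightarrow> prefix xs ys \<and> x \<in> set ys"
  by (auto simp: prefix_def)

lemma in_tag_le [simp]: "(v, t, j) \<in> tag_le r H \<longleftrightarrow> (v, t, j) \<in> H \<and> t \<le> r"
  by (auto simp: tag_le_def)

lemma tag_le_mono: "H \<subseteq> H' \<Longrightarrow> tag_le r H \<subseteq> tag_le r H'"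
  by (auto simp: tag_le_def)

lemma tag_le_subset: "tag_le r H \<subseteq> H"
  by (auto simp: tag_le_def)

lemma post_apply:
  "post i outs ch j l = (if j = i then ch j l @ msgs l outs else ch j l)"
  by (simp add: post_def msgs_def)

lemma msgs_in_sends: "m \<in> set (msgs l outs) \<longleftrightarrow> (\<exists>A. l \<in> A \<and> (A, m) \<in> set outs)"
  by (force simp: msgs_def)

lemma interrupted_subset:
  "interrupted outs outs' \<Longrightarrow> (A', m) \<in> set outs' \<Longrightarrow> \<exists>A. (A, m) \<in> set outs \<and> A' \<subseteq> A"
  by (fastforce simp: interrupted_def)

lemma interrupted_Nil [simp]: "\<not> interrupted [] outs'"
  by (simp add: interrupted_def)

lemma interrupted_Cons:
  "interrupted ((A, m) # outs) outs' \<longleftrightarrow>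
     (\<exists>A' \<subseteq> A. outs' = [(A', m)]) \<or> (\<exists>vs. outs' = (A, m) # vs \<and> interrupted outs vs)"
  (is "?L \<longleftrightarrow> ?R")
proof
  assume ?L
  then obtain us B B' m' vs where *: "(A, m) # outs = us @ (B, m') # vs" "B' \<subseteq> B"
      "outs' = us @ [(B', m')]"
    unfolding interrupted_def by blast
  show ?R
  proof (cases us)
    case Nil
    then show ?thesis using * by simp
  next
    case (Cons u us')
    with * have "interrupted outs (us' @ [(B', m')])" "outs' = (A, m) # us' @ [(B', m')]"
      unfolding interrupted_def by auto
    then show ?thesis by blast
  qed
next
  assume ?R
  then show ?L
  proof
    assume "\<exists>A' \<subseteq> A. outs' = [(A', m)]"
    then show ?L unfolding interrupted_def by (intro exI[of _ "[]"]) auto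
  next
    assume "\<exists>vs. outs' = (A, m) # vs \<and> interrupted outs vs"
    then obtain us B B' m' vs where "outs = us @ (B, m') # vs" "B' \<subseteq> B"
      "outs' = (A, m) # us @ [(B', m')]"
      unfolding interrupted_def by blast
    then show ?L
      unfolding interrupted_def by (intro exI[of _ "(A, m) # us"]) auto
  qed
qed

section \<open>Local steps and the messages they send\<close>

lemma advance_frame:
  assumes "advance f init i s s' outs res"
  shows "V s' = V s \<and> maxTag s' = maxTag s \<and> D s' = D s \<and> goods s' = goods s \<and> req s \<le> req s'"
  using assms by cases (auto simp: begin_lattice_def)

lemma handle_frame:
  "ctrl (fst (handle i j m s)) = ctrl s \<and> req (fst (handle i j m s)) = req s \<and>
   V s k \<subseteq> V (fst (handle i j m s)) k \<and> maxTag s \<le> maxTag (fst (handle i j m s))"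
  by (cases m) auto

lemma vals_msgs:
  "\<forall>B x. (B, Value x) \<in> set outs \<longrightarrow> l \<in> B \<Longrightarrow> vals (msgs l outs) = vals (map snd outs)"
proof (induction outs)
  case (Cons u outs)
  then have "vals (msgs l outs) = vals (map snd outs)" by (meson list.set_intros(2))
  moreover obtain B m where "u = (B, m)" by fastforce
  ultimately show ?case using Cons.prems by (cases m) auto
qed simp

text \<open>A necessary condition for sending \<open>m\<close>, read off the configuration before
  the step. The argument \<open>outs\<close> is the complete list that the step would send: a crash
  may cut it, and then the position of an acknowledgement or of \<open>GoodLA\<close> in the list
  matters.\<close>

fun sent_in :: "nat \<Rightarrow> 'n::finite \<Rightarrow> ('n, 'v) config \<Rightarrow> ('n, 'v) sends \<Rightarrow> 'n set \<Rightarrow> ('n, 'v) msg \<Rightarrow> bool"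
where
  "sent_in f i C outs B (Value x) \<longleftrightarrow> B = UNIV \<and>
     ((\<exists>v. ctrl (nodes C i) = ReadWait (Update v) \<and> card (acks (nodes C i)) \<ge> CARD('n) - f \<and>
         x = (v, Max (snd ` acks (nodes C i)) + 1, i))
      \<or> (\<exists>j ms. chan C j i = Value x # ms))"
| "sent_in f i C outs B (ReadTag q) \<longleftrightarrow>
     (\<exists>op. ctrl (nodes C i) = Start op) \<and>
     outs = [(UNIV, ReadTag (Suc (req (nodes C i))))] \<and> q = Suc (req (nodes C i))"
| "sent_in f i C outs B (WriteTag q r) \<longleftrightarrow> (\<forall>op. ctrl (nodes C i) \<noteq> Start op) \<and> q = Suc (req (nodes C i))"
| "sent_in f i C outs B (ReadAck q r) \<longleftrightarrow>
     (\<exists>j ms. chan C j i = ReadTag q # ms \<and> r = maxTag (nodes C i) \<and> B = {j} \<and>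
        outs = [({j}, ReadAck q r)])"
| "sent_in f i C outs B (WriteAck q r) \<longleftrightarrow>
     (\<exists>j ms. chan C j i = WriteTag q r # ms \<and> B = {j} \<and>
        outs = [(UNIV, EchoTag r), ({j}, WriteAck q r)])"
| "sent_in f i C outs B (EchoTag r) \<longleftrightarrow> True"
| "sent_in f i C outs B (GoodLA r) \<longleftrightarrow>
     (\<exists>op p. ctrl (nodes C i) = EqWait op p r) \<and> EQ f (\<lambda>j. tag_le r (V (nodes C i) j)) i \<and>
     maxTag (nodes C i) \<le> r \<and> (\<exists>vs. outs = (UNIV, GoodLA r) # vs \<and> (\<forall>B. (B, GoodLA r) \<notin> set vs))"

lemma node_step_sends:
  assumes "node_step f init C i e s' ch outs" "(B, m) \<in> set outs"
  shows "sent_in f i C outs B m"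
  using assms(1)
proof cases
  case (invoke op)
  then show ?thesis using assms(2) by simp
next
  case internal
  from internal(3) show ?thesis
    using assms(2) by cases (auto simp: write_tag_def split: if_splits)
next
  case (return y)
  from return(3) show ?thesis
    using assms(2) by cases auto
next
  case (deliver j m' ms)
  then show ?thesis
    using assms(2) by (cases m') (auto split: if_splits)
qed

primrec precedes :: "'a \<Rightarrow> 'a \<Rightarrow> 'a list \<Rightarrow> bool" where
  "precedes a b [] \<longleftrightarrow> True"
| "precedes a b (c # xs) \<longleftrightarrow> c \<noteq> b \<and> (c = a \<or> precedes a b xs)"

lemma precedes_append [simp]:
  "precedes a b (xs @ ys) \<longleftrightarrow> precedes a b xs \<and> (a \<in> set xs \<or> precedes a b ys)"
  by (induction xs) auto

lemma precedes_notin: "b \<notin> set xs \<Longrightarrow> precedes a b xs"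
  by (induction xs) auto

lemma precedesD: "precedes a b xs \<Longrightarrow> prefix (us @ [b]) xs \<Longrightarrow> a \<in> set us"
  by (auto simp: prefix_def)

text \<open>
  A finite execution is continued by steps that change nothing. The flag \<open>ok k\<close> tells that the
  acting node \<open>act k\<close> takes a proper step, so that crashes and the added steps have
  \<open>ok k = False\<close>, and \<open>out k\<close> is what is actually sent.
\<close>

locale run =
  fixes f :: nat
    and init :: "'n::finite \<Rightarrow> 'v"
    and C :: "nat \<Rightarrow> ('n, 'v) config"
    and ev :: "nat \<Rightarrow> ('n, 'v) event"
    and act :: "nat \<Rightarrow> 'n"
    and out :: "nat \<Rightarrow> ('n, 'v) sends"
    and ok :: "nat \<Rightarrow> bool"
  assumes minority: "2 * f < CARD('n)"
    and initial: "C 0 = init_config"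
    and ok_step: "ok k \<Longrightarrow> act k \<notin> crashed (C k) \<and>
      (\<exists>s' ch. node_step f init (C k) (act k) (ev k) s' ch (out k) \<and>
         C (Suc k) = (C k)\<lparr>nodes := (nodes (C k))(act k := s'), chan := post (act k) (out k) ch\<rparr>)"
    and not_ok_step: "\<not> ok k \<Longrightarrow>
      nodes (C (Suc k)) = nodes (C k) \<and> crashed (C k) \<subseteq> crashed (C (Suc k)) \<and>
      (\<forall>j i. i \<notin> crashed (C (Suc k)) \<longrightarrow>
         chan (C (Suc k)) j i = chan (C k) j i @ (if j = act k then msgs i (out k) else [])) \<and>
      (out k \<noteq> [] \<longrightarrow> act k \<notin> crashed (C k) \<and> act k \<in> crashed (C (Suc k)) \<and>
         (\<exists>e s' ch outs. node_step f init (C k) (act k) e s' ch outs \<and> interrupted outs (out k)))"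
begin

abbreviation st :: "nat \<Rightarrow> 'n \<Rightarrow> ('n, 'v) node_state" where
  "st k i \<equiv> nodes (C k) i"

abbreviation X :: "nat \<Rightarrow> 'n set" where
  "X k \<equiv> crashed (C k)"

primrec rcv :: "nat \<Rightarrow> 'n \<Rightarrow> 'n \<Rightarrow> ('n, 'v) msg list" where
  "rcv 0 = (\<lambda>_ _. [])"
| "rcv (Suc k) = (\<lambda>j i. rcv k j i @
     (if ok k \<and> ev k = Deliver j i then [hd (chan (C k) j i)] else []))"

primrec snt :: "nat \<Rightarrow> 'n \<Rightarrow> 'n \<Rightarrow> ('n, 'v) msg list" where
  "snt 0 = (\<lambda>_ _. [])"
| "snt (Suc k) = (\<lambda>j i. snt k j i @ (if j = act k then msgs i (out k) else []))"

text \<open>The values multicast by a node, including one of which a crash lost some copies.\<close>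

primrec mcast :: "nat \<Rightarrow> 'n \<Rightarrow> ('n, 'v) stamped list" where
  "mcast 0 = (\<lambda>_. [])"
| "mcast (Suc k) = (\<lambda>j. mcast k j @ (if j = act k then vals (map snd (out k)) else []))"

text \<open>The position of the latest invocation at a node, which identifies its operation. It
  keeps its value after the operation returns; 0 is a dummy before the first invocation.\<close>

primrec start :: "nat \<Rightarrow> 'n \<Rightarrow> nat" where
  "start 0 = (\<lambda>_. 0)"
| "start (Suc k) = (\<lambda>i. if ok k \<and> (\<exists>op. ev k = Invoke i op) then k else start k i)"

section \<open>Channel histories\<close>

lemma crashed_Suc: "ok k \<Longrightarrow> X (Suc k) = X k"
  using ok_step[of k] by auto

lemma crashed_mono: "k \<le> k' \<Longrightarrow> X k \<subseteq> X k'"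
proof (induction k' rule: dec_induct)
  case (step m)
  have "X m \<subseteq> X (Suc m)"
    using crashed_Suc[of m] not_ok_step[of m] by (cases "ok m") auto
  with step show ?case by blast
qed simp

lemma alive_earlier: "i \<notin> X k' \<Longrightarrow> k \<le> k' \<Longrightarrow> i \<notin> X k"
  using crashed_mono by blast

lemma event_of_act:
  assumes "ok k"
  shows "ev k = Deliver j i \<Longrightarrow> act k = i" "ev k = Invoke i op \<Longrightarrow> act k = i"
    "ev k = Return i y \<Longrightarrow> act k = i"
  using ok_step[OF assms] by (auto elim: node_step.cases)

lemma act_cases [consumes 1, case_names invoke advance deliver]:
  assumes "ok k"
  obtains (invoke) op where "ev k = Invoke (act k) op" "ctrl (st k (act k)) = Idle"
      "st (Suc k) (act k) = (st k (act k))\<lparr>ctrl := Start op\<rparr>" "out k = []"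
      "\<And>j i. rcv (Suc k) j i = rcv k j i" "start (Suc k) (act k) = k"
  | (advance) res where
      "advance f init (act k) (st k (act k)) (st (Suc k) (act k)) (out k) res"
      "ev k = (case res of None \<Rightarrow> Internal (act k) | Some y \<Rightarrow> Return (act k) y)"
      "\<And>j i. rcv (Suc k) j i = rcv k j i" "start (Suc k) (act k) = start k (act k)"
  | (deliver) j m ms where "ev k = Deliver j (act k)" "chan (C k) j (act k) = m # ms"
      "st (Suc k) (act k) = fst (handle (act k) j m (st k (act k)))"
      "out k = snd (handle (act k) j m (st k (act k)))"
      "rcv (Suc k) j (act k) = rcv k j (act k) @ [m]"
      "\<And>j'. j' \<noteq> j \<Longrightarrow> rcv (Suc k) j' (act k) = rcv k j' (act k)"
      "start (Suc k) (act k) = start k (act k)"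
      "\<nexists>s'' outs'' res. advance f init (act k) (st k (act k)) s'' outs'' res"
proof -
  from ok_step[OF assms] obtain s' ch where
    *: "node_step f init (C k) (act k) (ev k) s' ch (out k)" "st (Suc k) (act k) = s'"
    by auto
  from *(1) show thesis
  proof cases
    case (invoke op)
    then show ?thesis using * assms by (intro that(1)) auto
  next
    case internal
    then show ?thesis using * assms by (intro that(2)[of None]) auto
  next
    case (return y)
    then show ?thesis using * assms by (intro that(2)[of "Some y"]) auto
  next
    case (deliver j m ms)
    then show ?thesis using * assms by (intro that(3)[of j m ms]) auto
  qed
qed

lemma unchanged:
  assumes "\<not> (ok k \<and> act k = i)"
  shows "st (Suc k) i = st k i" "rcv (Suc k) j i = rcv k j i" "start (Suc k) i = start k i"
  using assms ok_step[of k] not_ok_step[of k] event_of_act[of k]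
  by (cases "ok k"; auto)+

text \<open>A step without \<open>ok\<close> that sends something crashes its sender, so a node that
  is still alive afterwards has sent messages only in proper steps.\<close>

lemma unsent:
  assumes "\<not> (ok k \<and> act k = i)" "i \<notin> X (Suc k)"
  shows "snt (Suc k) i l = snt k i l" "mcast (Suc k) i = mcast k i"
  using assms not_ok_step[of k] by (auto simp: not_Cons_self)

lemma prefix_le:
  assumes "\<And>k. prefix (g k) (g (Suc k))" "k \<le> k'"
  shows "prefix (g k) (g k')"
  using assms(2) by (induction k' rule: dec_induct) (auto intro: prefix_order.trans assms(1))

lemma rcv_mono: "k \<le> k' \<Longrightarrow> prefix (rcv k j i) (rcv k' j i)"
  by (rule prefix_le) auto

lemma snt_mono: "k \<le> k' \<Longrightarrow> prefix (snt k j i) (snt k' j i)"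
  by (rule prefix_le) auto

lemma mcast_mono: "k \<le> k' \<Longrightarrow> prefix (mcast k j) (mcast k' j)"
  by (rule prefix_le) auto

text \<open>The receiver has to be alive: a crash in the middle of a delivery takes the message off
  the channel without recording it as received.\<close>

lemma fifo: "i \<notin> X k \<Longrightarrow> snt k j i = rcv k j i @ chan (C k) j i"
proof (induction k)
  case 0
  then show ?case by (simp add: initial init_config_def)
next
  case (Suc k)
  then have IH: "snt k j i = rcv k j i @ chan (C k) j i"
    using alive_earlier by simp
  show ?case
  proof (cases "ok k")
    case False
    then show ?thesis using not_ok_step[of k] IH Suc by auto
  next
    case True
    from ok_step[OF True] obtain s' ch where
      *: "node_step f init (C k) (act k) (ev k) s' ch (out k)"
        "chan (C (Suc k)) = post (act k) (out k) ch"
      by auto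
    from *(1) show ?thesis
      using * IH True by cases (auto simp: post_apply)
  qed
qed

text \<open>Unlike \<open>fifo\<close>, this survives the crash of the receiver, since
  \<open>rcv\<close> then stops growing.\<close>

lemma rcv_prefix_snt: "prefix (rcv k j i) (snt k j i)"
proof (induction k)
  case (Suc k)
  show ?case
  proof (cases "ok k \<and> act k = i")
    case True
    then have "i \<notin> X (Suc k)"
      using ok_step crashed_Suc by auto
    then show ?thesis using fifo[of i "Suc k" j] by simp
  next
    case False
    then show ?thesis
      using Suc unchanged(2)[of k i j] by (auto intro: prefix_prefix simp del: rcv.simps)
  qed
qed simp

lemma next_message:
  "i \<notin> X k \<Longrightarrow> chan (C k) j i = m # ms \<Longrightarrow> prefix (rcv k j i @ [m]) (snt k j i)"
  using fifo by simp

lemma sent_in_out: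
  assumes "(A, m) \<in> set (out k)"
  obtains B outs where "act k \<notin> X k" "A \<subseteq> B" "sent_in f (act k) (C k) outs B m"
    "out k = outs \<or> \<not> ok k \<and> interrupted outs (out k)"
proof (cases "ok k")
  case True
  with ok_step[of k] show ?thesis
    using assms node_step_sends that[of A "out k"] by blast
next
  case False
  with not_ok_step[of k] assms obtain e s' ch outs where
    *: "node_step f init (C k) (act k) e s' ch outs" "interrupted outs (out k)" "act k \<notin> X k"
    by auto
  with interrupted_subset assms obtain B where "(B, m) \<in> set outs" "A \<subseteq> B"
    by metis
  then show ?thesis
    using that[of B outs] * False node_step_sends by blast
qed

lemma not_ok_crashes: "\<not> ok k \<Longrightarrow> out k \<noteq> [] \<Longrightarrow> act k \<in> X (Suc k)"
  using not_ok_step by blast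

text \<open>Values are always multicast to all nodes, so the channels leaving \<open>j\<close> carry
  the same sequence of values; a crash cuts at most the last multicast. This makes
  \<open>mcast k j\<close> the common reference for comparing what different nodes have received
  from \<open>j\<close>.\<close>

lemma mcast_snt:
  "prefix (vals (snt k j i)) (mcast k j) \<and> (j \<notin> X k \<longrightarrow> vals (snt k j i) = mcast k j)"
proof (induction k)
  case (Suc k)
  show ?case
  proof (cases "j = act k \<and> out k \<noteq> []")
    case False
    then show ?thesis using Suc crashed_mono[of k "Suc k"] by auto
  next
    case True
    then have alive: "j \<notin> X k"
      using ok_step not_ok_step by (cases "ok k") auto
    then have eq: "vals (snt k j i) = mcast k j" using Suc by simp
    show ?thesis
    proof (cases "ok k")
      case True
      then obtain s' ch where "node_step f init (C k) (act k) (ev k) s' ch (out k)"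
        using ok_step by blast
      then have "vals (msgs i (out k)) = vals (map snd (out k))"
        by (intro vals_msgs allI impI) (auto dest!: node_step_sends)
      then show ?thesis using eq by simp
    next
      case False
      with True not_ok_step[of k] obtain e s' ch outs where
        *: "node_step f init (C k) (act k) e s' ch outs" "interrupted outs (out k)" "j \<in> X (Suc k)"
        by auto
      from *(2) obtain us A A' m vs where
        **: "outs = us @ (A, m) # vs" "out k = us @ [(A', m)]"
        unfolding interrupted_def by blast
      have "vals (msgs i us) = vals (map snd us)"
        using node_step_sends[OF *(1)] ** by (intro vals_msgs allI impI) fastforce
      then show ?thesis using eq * ** by (auto split: msg.split)
    qed
  qed
qed simp

lemma snt_mcast: "Value x \<in> set (snt k j i) \<Longrightarrow> x \<in> set (mcast k j)"
  using mcast_snt[of k j i] by (metis prefix_in_set set_vals)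

lemma mcast_snt_alive: "j \<notin> X k \<Longrightarrow> x \<in> set (mcast k j) \<Longrightarrow> Value x \<in> set (snt k j i)"
  using mcast_snt[of k j i] by (metis set_vals)

declare rcv.simps(2) [simp del] snt.simps(2) [simp del] mcast.simps(2) [simp del]
  start.simps(2) [simp del]

section \<open>Local states in terms of received messages\<close>

lemma V_rcv:
  "V (st k i) j = {x. \<exists>l. (j = i \<or> j = l) \<and> Value x \<in> set (rcv k l i)}"
proof (induction k arbitrary: j)
  case 0
  then show ?case by (simp add: initial init_config_def init_node_def)
next
  case (Suc k)
  show ?case
  proof (cases "ok k \<and> act k = i")
    case False
    then show ?thesis using Suc by (simp add: unchanged)
  next
    case True
    then have "ok k" by simp
    then show ?thesis
    proof (cases rule: act_cases)
      case (invoke op)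
      then show ?thesis using Suc True by simp
    next
      case (advance res)
      then show ?thesis using Suc True advance_frame[OF advance(1)] by simp
    next
      case (deliver l m ms)
      have rcv: "rcv (Suc k) l' i = rcv k l' i @ (if l' = l then [m] else [])" for l'
        using deliver(5,6) True by auto
      show ?thesis
        using deliver(3) True Suc
        by (cases m) (auto simp: rcv split: if_splits)
    qed
  qed
qed

lemma V_own: "x \<in> V (st k i) i \<longleftrightarrow> (\<exists>l. Value x \<in> set (rcv k l i))"
  by (auto simp: V_rcv)

lemma V_other: "j \<noteq> i \<Longrightarrow> V (st k i) j = set (vals (rcv k j i))"
  by (auto simp: V_rcv)

lemma frame_Suc:
  "V (st k i) j \<subseteq> V (st (Suc k) i) j \<and> maxTag (st k i) \<le> maxTag (st (Suc k) i) \<and>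
   req (st k i) \<le> req (st (Suc k) i)"
proof (cases "ok k \<and> act k = i")
  case False
  then show ?thesis by (simp add: unchanged)
next
  case True
  then have "ok k" by simp
  then show ?thesis
  proof (cases rule: act_cases)
    case (deliver l m ms)
    then show ?thesis using True handle_frame[of i l m _ j] by auto
  qed (use True in \<open>auto dest: advance_frame\<close>)
qed

lemma frame_mono:
  assumes "k \<le> k'"
  shows "V (st k i) j \<subseteq> V (st k' i) j" "maxTag (st k i) \<le> maxTag (st k' i)"
    "req (st k i) \<le> req (st k' i)"
  using assms by (induction k' rule: dec_induct; use frame_Suc in \<open>meson order.refl order.trans\<close>)+

lemma tag_received:
  "EchoTag r \<in> set (rcv k j i) \<or> WriteTag q r \<in> set (rcv k j i) \<Longrightarrow> r \<le> maxTag (st k i)"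
proof (induction k)
  case (Suc k)
  show ?case
  proof (cases "EchoTag r \<in> set (rcv k j i) \<or> WriteTag q r \<in> set (rcv k j i)")
    case True
    then show ?thesis using Suc frame_Suc[of k i] by (metis order.trans)
  next
    case False
    then have *: "rcv (Suc k) j i \<noteq> rcv k j i" using Suc.prems by metis
    then have i: "ok k" "act k = i" using unchanged(2) by metis+
    from i(1) show ?thesis
    proof (cases rule: act_cases)
      case (deliver l m ms)
      have "l = j" using * deliver i by metis
      then have "m = EchoTag r \<or> m = WriteTag q r" using False Suc.prems deliver(5) i by auto
      then show ?thesis using deliver(3) i by auto
    qed (use * i in auto)
  qed
qed simp

text \<open>A new value enters the own entry in the very step that forwards it; a crash during this
  step leaves the entry as it was.\<close>

lemma V_own_mcast: "V (st k j) j \<subseteq> set (mcast k j)"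
proof (induction k)
  case 0
  then show ?case by (auto simp: V_own)
next
  case (Suc k)
  show ?case
  proof (cases "ok k \<and> act k = j")
    case False
    then show ?thesis using Suc mcast_mono[of k "Suc k" j] by (auto simp: unchanged dest: prefix_in_set)
  next
    case True
    then have "ok k" by simp
    then show ?thesis
    proof (cases rule: act_cases)
      case (deliver l m ms)
      show ?thesis
      proof
        fix x assume x: "x \<in> V (st (Suc k) j) j"
        show "x \<in> set (mcast (Suc k) j)"
        proof (cases "x \<in> V (st k j) j")
          case True
          then show ?thesis using Suc mcast_mono[of k "Suc k" j] by (auto dest: prefix_in_set)
        next
          case False
          then have "(UNIV, Value x) \<in> set (out k)"
            using x deliver(3,4) \<open>ok k \<and> act k = j\<close> by (cases m) (auto split: if_splits)
          then have "Value x \<in> snd ` set (out k)" by force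
          then show ?thesis using \<open>ok k \<and> act k = j\<close> by (auto simp: mcast.simps)
        qed
      qed
    qed (use True Suc mcast_mono[of k "Suc k" j] in \<open>auto dest!: advance_frame dest: prefix_in_set\<close>)
  qed
qed

section \<open>Origins of messages and freshness of requests\<close>

lemma snt_origin:
  "prefix (us @ [m]) (snt k l j) \<Longrightarrow>
   \<exists>t<k. \<exists>xs ys. act t = l \<and> us = snt t l j @ xs \<and> msgs j (out t) = xs @ m # ys"
proof (induction k)
  case (Suc k)
  consider "prefix (us @ [m]) (snt k l j)"
    | zs where "us @ [m] = snt k l j @ zs" "prefix zs (if l = act k then msgs j (out k) else [])"
      "\<not> prefix (us @ [m]) (snt k l j)"
    using Suc.prems unfolding snt.simps prefix_append by blast
  then show ?case
  proof cases
    case 1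
    then show ?thesis using Suc.IH less_Suc_eq by blast
  next
    case 2
    then have "zs \<noteq> []" by auto
    with 2(1) obtain xs where zs: "zs = xs @ [m]"
      by (metis append_butlast_last_id last_appendR last_snoc)
    then have "l = act k" "us = snt k l j @ xs" "prefix (xs @ [m]) (msgs j (out k))"
      using 2 by (auto split: if_splits)
    then show ?thesis by (auto simp: prefix_def)
  qed
qed simp

lemma rcv_origin:
  assumes "m \<in> set (rcv k l j)"
  obtains t xs ys where "t < k" "act t = l" "msgs j (out t) = xs @ m # ys"
    "prefix (snt t l j @ xs @ [m]) (rcv k l j)"
proof -
  from assms obtain us vs where *: "rcv k l j = us @ m # vs" by (meson split_list)
  then have p: "prefix (us @ [m]) (rcv k l j)" by simp
  then have "prefix (us @ [m]) (snt k l j)"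
    using rcv_prefix_snt prefix_order.trans by blast
  from snt_origin[OF this] p show thesis using that by auto
qed

lemma snt_act: "snt (Suc k) (act k) l = snt k (act k) l @ msgs l (out k)"
  by (simp add: snt.simps)

text \<open>Only for a live node: one that crashes while sending a request emits the number
  \<open>Suc (req s)\<close> without having increased \<open>req\<close>.\<close>

lemma request_le_req:
  "i \<notin> X k \<Longrightarrow> (ReadTag q \<in> set (snt k i l) \<longrightarrow> q \<le> req (st k i)) \<and>
     (WriteTag q r \<in> set (snt k i l) \<longrightarrow> q \<le> req (st k i))"
proof (induction k)
  case (Suc k)
  have IH: "(ReadTag q \<in> set (snt k i l) \<longrightarrow> q \<le> req (st k i)) \<and>
     (WriteTag q r \<in> set (snt k i l) \<longrightarrow> q \<le> req (st k i))"
    using Suc alive_earlier by simp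
  show ?case
  proof (cases "ok k \<and> act k = i")
    case False
    then show ?thesis using IH Suc.prems by (simp add: unchanged unsent)
  next
    case True
    then have "ok k" by simp
    then show ?thesis
    proof (cases rule: act_cases)
      case (invoke op)
      then show ?thesis using IH True snt_act[of k l] by simp
    next
      case (advance res)
      from advance(1) show ?thesis
        using IH True snt_act[of k l] by cases (auto simp: begin_lattice_def write_tag_def)
    next
      case (deliver j m ms)
      then show ?thesis
        using IH True snt_act[of k l] by (cases m) auto
    qed
  qed
qed simp

abbreviation writing :: "nat \<Rightarrow> 'n \<Rightarrow> 'v opn \<Rightarrow> nat \<Rightarrow> nat \<Rightarrow> bool" where
  "writing k i op p r \<equiv> ctrl (st k i) = WriteWait op p r \<or> ctrl (st k i) = EqWait op p r"

text \<open>Every request number is new when it is first used, so the current number determines the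
  kind of request and its tag, and no \<open>ReadTag\<close> repeats. The clause with
  \<open>precedes\<close> records that an UPDATE sends its value ahead of the write request of phase
  0 on every channel.\<close>

lemma request_kind:
  assumes "i \<notin> X k"
  shows "(ctrl (st k i) = ReadWait op \<longrightarrow> WriteTag (req (st k i)) r' \<notin> set (snt k i l)) \<and>
     (writing k i op p r \<longrightarrow> ReadTag (req (st k i)) \<notin> set (snt k i l) \<and>
        (WriteTag (req (st k i)) r' \<in> set (snt k i l) \<longrightarrow> r' = r)) \<and>
     (writing k i (Update v) 0 r \<longrightarrow>
        precedes (Value (v, r + 1, i)) (WriteTag (req (st k i)) r) (snt k i l)) \<and>
     count_list (snt k i l) (ReadTag q) \<le> 1"
  (is "?P k")
  using assms
proof (induction k)
  case 0
  then show ?case by (simp add: initial init_config_def init_node_def)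
next
  case (Suc k)
  then have i: "i \<notin> X k" using alive_earlier by simp
  with Suc have IH: "?P k" by simp
  have new: "ReadTag (Suc (req (st k i))) \<notin> set (snt k i l)"
    "WriteTag (Suc (req (st k i))) r' \<notin> set (snt k i l)" for r'
    using request_le_req[OF i] by (meson Suc_n_not_le_n)+
  show ?case
  proof (cases "ok k \<and> act k = i")
    case False
    then show ?thesis using IH Suc.prems by (simp add: unchanged unsent)
  next
    case True
    then have "ok k" by simp
    then show ?thesis
    proof (cases rule: act_cases)
      case (invoke op)
      then show ?thesis using IH True snt_act[of k l] by simp
    next
      case (advance res)
      from advance(1) show ?thesis
        using IH True snt_act[of k l] new
        by cases (auto simp: begin_lattice_def write_tag_def precedes_notin count_list_0_iff)
    next
      case (deliver j m ms)
      then show ?thesis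
        using IH True snt_act[of k l] by (cases m) auto
    qed
  qed
qed

lemma acks_received:
  "(l, r) \<in> acks (st k i) \<Longrightarrow>
     ReadAck (req (st k i)) r \<in> set (rcv k l i) \<or> WriteAck (req (st k i)) r \<in> set (rcv k l i)"
proof (induction k)
  case 0
  then show ?case by (simp add: initial init_config_def init_node_def)
next
  case (Suc k)
  show ?case
  proof (cases "ok k \<and> act k = i")
    case False
    then show ?thesis using Suc by (simp add: unchanged)
  next
    case True
    then have "ok k" by simp
    then show ?thesis
    proof (cases rule: act_cases)
      case (invoke op)
      then show ?thesis using Suc True by simp
    next
      case (advance res)
      from advance(1) show ?thesis
        using Suc advance(3) True by cases (auto simp: begin_lattice_def)
    next
      case (deliver j m ms)
      have rcv: "rcv (Suc k) l' i = rcv k l' i @ (if l' = j then [m] else [])" for l'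
        using deliver(5,6) True by auto
      from deliver show ?thesis
        using Suc True by (cases m) (auto simp: rcv split: if_splits)
    qed
  qed
qed

text \<open>A node that crashes while answering never records the request as received. Hence the
  last clause speaks only of later moments at which \<open>l\<close> is alive.\<close>

lemma read_ack_origin:
  assumes "ReadAck q r \<in> set (rcv k l i)"
  obtains t ms where "t < k" "act t = l" "l \<notin> X t" "chan (C t) i l = ReadTag q # ms"
    "r = maxTag (st t l)" "\<And>k'. t < k' \<Longrightarrow> l \<notin> X k' \<Longrightarrow> ReadTag q \<in> set (rcv k' i l)"
proof -
  from assms obtain t xs ys where
    t: "t < k" "act t = l" "msgs i (out t) = xs @ ReadAck q r # ys"
    by (rule rcv_origin)
  then have "ReadAck q r \<in> set (msgs i (out t))" by simp
  then obtain A where A: "i \<in> A" "(A, ReadAck q r) \<in> set (out t)"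
    unfolding msgs_in_sends by blast
  from A(2) show thesis
  proof (rule sent_in_out)
    fix B outs
    assume *: "act t \<notin> X t" "A \<subseteq> B" "sent_in f (act t) (C t) outs B (ReadAck q r)"
      "out t = outs \<or> \<not> ok t \<and> interrupted outs (out t)"
    have "ReadTag q \<in> set (rcv k' i l)" if k': "t < k'" "l \<notin> X k'" for k'
    proof -
      have ok: "ok t"
        using k' t A not_ok_crashes[of t] crashed_mono[of "Suc t" k'] by fastforce
      then have out: "out t = [({i}, ReadAck q r)]"
        using * A by auto
      from ok have "ReadTag q \<in> set (rcv (Suc t) i l)"
      proof (cases rule: act_cases)
        case (invoke op)
        then show ?thesis using out by simp
      next
        case (advance res)
        from advance(1) show ?thesis
          using out by cases (auto simp: write_tag_def split: if_splits)
      next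
        case (deliver j m ms)
        then have "j = i \<and> m = ReadTag q"
          using out by (cases m) (auto split: if_splits)
        then show ?thesis using deliver(5) t by simp
      qed
      then show ?thesis using rcv_mono[of "Suc t" k'] k' prefix_in_set by fastforce
    qed
    then show thesis using that * t A by auto
  qed
qed

text \<open>Step \<open>t\<close> is the one in which \<open>l\<close> answers the write request,
  and the answer has reached \<open>i\<close> by \<open>k\<close>. It may be a crashing step, so
  receipt of the request is claimed only under \<open>ok t\<close>. That the echo is the first
  message of the step, on all channels, fixes what \<open>l\<close> had sent before.\<close>

definition acked :: "nat \<Rightarrow> 'n \<Rightarrow> 'n \<Rightarrow> nat \<Rightarrow> nat \<Rightarrow> nat \<Rightarrow> bool" where
  "acked k i l q r t \<longleftrightarrow> t < k \<and> act t = l \<and> l \<notin> X t \<and> (\<exists>ms. chan (C t) i l = WriteTag q r # ms) \<and>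
     prefix (snt t l i) (rcv k l i) \<and> EchoTag r \<in> set (rcv k l i) \<and>
     (\<forall>j. prefix (snt t l j @ [EchoTag r]) (snt (Suc t) l j)) \<and>
     (ok t \<longrightarrow> WriteTag q r \<in> set (rcv (Suc t) i l))"

lemma write_ack_origin:
  assumes "WriteAck q r \<in> set (rcv k l i)"
  obtains t where "acked k i l q r t"
proof -
  from assms obtain t xs ys where
    t: "t < k" "act t = l" "msgs i (out t) = xs @ WriteAck q r # ys"
      "prefix (snt t l i @ xs @ [WriteAck q r]) (rcv k l i)"
    by (rule rcv_origin)
  then have "WriteAck q r \<in> set (msgs i (out t))" by simp
  then obtain A where A: "i \<in> A" "(A, WriteAck q r) \<in> set (out t)"
    unfolding msgs_in_sends by blast
  from A(2) show thesis
  proof (rule sent_in_out)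
    fix B outs
    assume *: "act t \<notin> X t" "A \<subseteq> B" "sent_in f (act t) (C t) outs B (WriteAck q r)"
      "out t = outs \<or> \<not> ok t \<and> interrupted outs (out t)"
    then have outs: "outs = [(UNIV, EchoTag r), ({i}, WriteAck q r)]" using A by auto
    \<comment> \<open>The acknowledgement is the last entry of the list, so even a crash that lets
      it out has completed the multicast of the echo.\<close>
    then obtain B' where out: "out t = [(UNIV, EchoTag r), (B', WriteAck q r)]"
      using * A by (auto simp: interrupted_Cons)
    then have "xs = [EchoTag r]"
      using t(3) A(2) by (auto simp: Cons_eq_append_conv split: if_splits)
    then have "prefix (snt t l i) (rcv k l i)" "EchoTag r \<in> set (rcv k l i)"
      using t(4) by (auto simp: prefix_def)
    moreover have "WriteTag q r \<in> set (rcv (Suc t) i l)" if "ok t"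
      using that
    proof (cases rule: act_cases)
      case (invoke op)
      then show ?thesis using out by simp
    next
      case (advance res)
      from advance(1) show ?thesis
        using out by cases (auto simp: write_tag_def split: if_splits)
    next
      case (deliver j m ms)
      then have "j = i \<and> m = WriteTag q r"
        using out outs * that by (cases m) (auto split: if_splits)
      then show ?thesis using deliver(5) t by simp
    qed
    ultimately have "acked k i l q r t"
      unfolding acked_def using * t A out snt_act[of t] by auto
    then show thesis by (rule that)
  qed
qed

section \<open>Write quorums\<close>

definition write_quorum :: "nat \<Rightarrow> 'n \<Rightarrow> nat \<Rightarrow> nat \<Rightarrow> bool" where
  "write_quorum k i q r \<longleftrightarrow>
     (\<exists>A. card A \<ge> CARD('n) - f \<and> (\<forall>l\<in>A. WriteAck q r \<in> set (rcv k l i)))"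

lemma write_quorum_mono: "write_quorum k i q r \<Longrightarrow> k \<le> k' \<Longrightarrow> write_quorum k' i q r"
  unfolding write_quorum_def using rcv_mono prefix_in_set by metis

lemma quorum_pos: "CARD('n) - f > 0"
  using minority by simp

lemma quorums_meet:
  fixes A B :: "'n set"
  assumes "card A \<ge> CARD('n) - f" "card B \<ge> CARD('n) - f"
  obtains l where "l \<in> A" "l \<in> B"
proof -
  have "A \<inter> B \<noteq> {}"
  proof
    assume "A \<inter> B = {}"
    then have "card (A \<union> B) = card A + card B" by (simp add: card_Un_disjoint)
    moreover have "card (A \<union> B) \<le> CARD('n)" by (simp add: card_mono)
    ultimately show False using assms minority by linarith
  qed
  then show thesis using that by blast
qed

text \<open>The field \<open>acks\<close> does not tell read from write acknowledgements. Their
  request number does, by \<open>request_kind\<close>.\<close>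

lemma write_acks:
  assumes "i \<notin> X k" "ctrl (st k i) = WriteWait op p r" "(l, r') \<in> acks (st k i)"
  shows "r' = r \<and> WriteAck (req (st k i)) r \<in> set (rcv k l i)"
proof -
  have in_snt: "m \<in> set (snt k i l)" if "t < k" "l \<notin> X t" "chan (C t) i l = m # ms" for t m ms
    using next_message[OF that(2,3)] snt_mono[of t k i l] that(1)
    by (meson less_imp_le prefix_in_set prefix_snocD)
  from acks_received[OF assms(3)] show ?thesis
  proof
    assume "ReadAck (req (st k i)) r' \<in> set (rcv k l i)"
    then obtain t ms where "t < k" "l \<notin> X t" "chan (C t) i l = ReadTag (req (st k i)) # ms"
      by (rule read_ack_origin)
    then have "ReadTag (req (st k i)) \<in> set (snt k i l)" by (rule in_snt)
    then show ?thesis using request_kind[OF assms(1)] assms(2) by metis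
  next
    assume *: "WriteAck (req (st k i)) r' \<in> set (rcv k l i)"
    then obtain t where "acked k i l (req (st k i)) r' t"
      by (rule write_ack_origin)
    then have "WriteTag (req (st k i)) r' \<in> set (snt k i l)"
      unfolding acked_def using in_snt by blast
    then show ?thesis using request_kind[OF assms(1)] assms(2) * by metis
  qed
qed

lemma EqWait_write_quorum:
  "ctrl (st k i) = EqWait op p r \<Longrightarrow> write_quorum k i (req (st k i)) r"
proof (induction k)
  case 0
  then show ?case by (simp add: initial init_config_def init_node_def)
next
  case (Suc k)
  show ?case
  proof (cases "ok k \<and> act k = i")
    case False
    then show ?thesis
      using Suc write_quorum_mono[of k i _ _ "Suc k"] by (simp add: unchanged)
  next
    case True
    then have "ok k" by simp
    then show ?thesis
    proof (cases rule: act_cases)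
      case (invoke op)
      then show ?thesis using Suc True by simp
    next
      case (advance res)
      from advance(1) have *: "ctrl (st k i) = WriteWait op p r" "card (acks (st k i)) \<ge> CARD('n) - f"
        "req (st (Suc k) i) = req (st k i)"
        using Suc.prems True by (cases; simp add: begin_lattice_def)+
      have alive: "i \<notin> X k" using True ok_step by blast
      \<comment> \<open>The program counts pairs of sender and tag. As all recorded tags equal
        \<open>r\<close>, it has counted distinct senders.\<close>
      have "inj_on fst (acks (st k i))"
        using write_acks[OF alive *(1)] by (auto simp: inj_on_def)
      then have "card (fst ` acks (st k i)) \<ge> CARD('n) - f"
        using *(2) by (simp add: card_image)
      then have "write_quorum k i (req (st k i)) r"
        unfolding write_quorum_def using write_acks[OF alive *(1)] by fastforce
      then show ?thesis using *(3) write_quorum_mono[of k i _ _ "Suc k"] by simp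
    next
      case (deliver j m ms)
      then show ?thesis
        using Suc True write_quorum_mono[of k i _ _ "Suc k"] handle_frame[of i j m "st k i"] by simp
    qed
  qed
qed

section \<open>The current operation of a node\<close>

lemma start_le: "start k i \<le> k"
  by (induction k) (auto simp: start.simps)

fun op_of :: "'v control \<Rightarrow> 'v opn option" where
  "op_of Idle = None"
| "op_of (Start op) = Some op"
| "op_of (ReadWait op) = Some op"
| "op_of (WriteWait op p r) = Some op"
| "op_of (EqWait op p r) = Some op"
| "op_of (GoodWait op r) = Some op"

fun tag_of :: "'v control \<Rightarrow> nat option" where
  "tag_of (WriteWait op p r) = Some r"
| "tag_of (EqWait op p r) = Some r"
| "tag_of (GoodWait op r) = Some r"
| "tag_of _ = None"

lemma op_of_start:
  "op_of (ctrl (st k i)) = Some op \<Longrightarrow> start k i < k \<and> ok (start k i) \<and> ev (start k i) = Invoke i op"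
proof (induction k)
  case 0
  then show ?case by (simp add: initial init_config_def init_node_def)
next
  case (Suc k)
  show ?case
  proof (cases "ok k \<and> act k = i")
    case False
    then show ?thesis using Suc by (simp add: unchanged less_SucI)
  next
    case True
    then have "ok k" by simp
    then show ?thesis
    proof (cases rule: act_cases)
      case (invoke op')
      then show ?thesis using Suc True by simp
    next
      case (advance res)
      from advance(1) have "op_of (ctrl (st k i)) = Some op"
        using Suc.prems True by cases (auto simp: begin_lattice_def)
      then show ?thesis using Suc advance(4) True by (simp add: less_SucI)
    next
      case (deliver j m ms)
      then show ?thesis
        using Suc True handle_frame[of i j m "st k i"] by (simp add: less_SucI)
    qed
  qed
qed

lemma req_start:
  "op_of (ctrl (st k i)) = Some op \<Longrightarrow> ctrl (st k i) \<noteq> Start op \<Longrightarrow>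
   req (st (start k i) i) < req (st k i)"
proof (induction k)
  case 0
  then show ?case by (simp add: initial init_config_def init_node_def)
next
  case (Suc k)
  show ?case
  proof (cases "ok k \<and> act k = i")
    case False
    then show ?thesis using Suc by (simp add: unchanged)
  next
    case True
    then have "ok k" by simp
    then show ?thesis
    proof (cases rule: act_cases)
      case (invoke op')
      then show ?thesis using Suc True by simp
    next
      case (advance res)
      have le: "req (st (start k i) i) \<le> req (st k i)"
        using frame_mono(3) start_le by blast
      from advance(1) show ?thesis
        using Suc advance(4) True le by cases (auto simp: begin_lattice_def)
    next
      case (deliver j m ms)
      then show ?thesis
        using Suc True handle_frame[of i j m "st k i"] by simp
    qed
  qed
qed

text \<open>The current request number exceeds the value of \<open>req\<close> at the invocation,
  which bounds the numbers of all requests sent until then.\<close>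

lemma request_after_start:
  assumes "i \<notin> X k" "op_of (ctrl (st k i)) = Some op" "ctrl (st k i) \<noteq> Start op" "t \<le> k"
    "ReadTag (req (st k i)) \<in> set (snt t i l) \<or> WriteTag (req (st k i)) r \<in> set (snt t i l)"
  shows "start k i < t"
proof (rule ccontr)
  assume "\<not> start k i < t"
  then have "req (st t i) \<le> req (st (start k i) i)"
    using frame_mono(3) by simp
  also have "\<dots> < req (st k i)" using req_start assms by blast
  also have "\<dots> \<le> req (st t i)"
    using request_le_req[of i t] alive_earlier[OF assms(1,4)] assms(5) by blast
  finally show False by simp
qed

lemma acked_request: "acked k i l q r t \<Longrightarrow> prefix (rcv t i l @ [WriteTag q r]) (snt t i l)"
  unfolding acked_def using next_message by blast

lemma acked_after_start:
  assumes "i \<notin> X k" "ctrl (st k i) = EqWait op p r" "acked k i l (req (st k i)) r t"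
  shows "start k i < t"
proof -
  have "t \<le> k" using assms(3) unfolding acked_def by simp
  moreover have "WriteTag (req (st k i)) r \<in> set (snt t i l)"
    using acked_request[OF assms(3)] prefix_snocD by metis
  ultimately show ?thesis
    using request_after_start[OF assms(1), of op] assms(2) by auto
qed

text \<open>
  Since channels are FIFO, whatever a node has forwarded before acknowledging a tag arrives
  before the acknowledgement.
\<close>

lemma acked_mcast:
  assumes "acked k i l q r t" "x \<in> set (mcast t l)"
  shows "x \<in> V (st k i) i"
proof -
  have "Value x \<in> set (snt t l i)"
    using assms mcast_snt_alive unfolding acked_def by blast
  then have "Value x \<in> set (rcv k l i)"
    using assms(1) prefix_in_set unfolding acked_def by metis
  then show ?thesis by (auto simp: V_own)
qed

text \<open>
  Channels from a node to itself are asynchronous as well. A new value is nevertheless back before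
  the acknowledgements of phase 0, at the latest from the nodes that acknowledge.
\<close>

lemma mcast_own:
  "j \<notin> X k \<Longrightarrow> x \<in> set (mcast k j) \<Longrightarrow>
   x \<in> V (st k j) j \<or> (\<exists>v r. ctrl (st k j) = WriteWait (Update v) 0 r \<and> x = (v, r + 1, j))"
proof (induction k)
  case (Suc k)
  show ?case
  proof (cases "ok k \<and> act k = j")
    case False
    then show ?thesis using Suc alive_earlier[of j "Suc k" k] by (simp add: unchanged unsent)
  next
    case True
    then have ok: "ok k" and j: "j = act k" by auto
    then have alive: "j \<notin> X k" using ok_step by blast
    have mcast: "mcast (Suc k) j = mcast k j @ vals (map snd (out k))"
      using j by (simp add: mcast.simps)
    note IH = Suc.IH[OF alive]
    from ok show ?thesis
    proof (cases rule: act_cases)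
      case (invoke op)
      then show ?thesis using IH Suc.prems mcast j by auto
    next
      case (advance res)
      note frame = advance_frame[OF advance(1)]
      from advance(1) show ?thesis
      proof cases
        case (written op p r)
        then have prems: "x \<in> set (mcast k j)" using Suc.prems mcast by simp
        show ?thesis
        proof (cases "x \<in> V (st k j) j")
          case True
          then show ?thesis using frame j by simp
        next
          case False
          with IH prems obtain v where v: "op = Update v" "p = 0" "x = (v, r + 1, j)"
            using written j by auto
          have "card (acks (st k j)) > 0" using written quorum_pos j by simp
          then have "acks (st k j) \<noteq> {}" by auto
          then obtain l r' where "(l, r') \<in> acks (st k j)" by auto
          then have "WriteAck (req (st k j)) r \<in> set (rcv k l j)"
            using write_acks[OF alive] written j by blast
          then obtain t where t: "acked k j l (req (st k j)) r t"
            by (rule write_ack_origin)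
          then have "t \<le> k" unfolding acked_def by simp
          \<comment> \<open>The value precedes the request on the channel to \<open>l\<close>. So
            \<open>l\<close> had it, and had forwarded it, when it answered; by FIFO the forwarded
            copy is back before the answer.\<close>
          then have "prefix (rcv t j l @ [WriteTag (req (st k j)) r]) (snt k j l)"
            using acked_request[OF t] snt_mono prefix_order.trans by blast
          moreover have "precedes (Value x) (WriteTag (req (st k j)) r) (snt k j l)"
            using request_kind[OF alive] written v j by blast
          ultimately have "Value x \<in> set (rcv t j l)" by (rule precedesD[rotated])
          then have "x \<in> V (st t l) l" by (auto simp: V_own)
          then have "x \<in> V (st k j) j" using acked_mcast t V_own_mcast by blast
          then show ?thesis using frame j by simp
        qed
      qed (use IH Suc.prems mcast j frame in \<open>auto simp: begin_lattice_def write_tag_def split: if_splits\<close>)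
    next
      case (deliver l m ms)
      then show ?thesis
        using IH Suc.prems mcast j by (cases m) (auto split: if_splits)
    qed
  qed
qed simp

lemma EqWait_mcast:
  "i \<notin> X k \<Longrightarrow> ctrl (st k i) = EqWait op p r \<Longrightarrow> V (st k i) i = set (mcast k i)"
  using mcast_own[of i k] V_own_mcast[of k i] by auto

text \<open>For \<open>j = i\<close> this needs the own values to be back, as they are in
  \<open>EqWait\<close>. Uniformity in \<open>j\<close> lets the common member of two quorums be any
  node, including one of the two that are compared.\<close>

lemma EqWait_prefix:
  assumes "i \<notin> X k" "ctrl (st k i) = EqWait op p r"
  obtains xs where "prefix xs (mcast k j)" "V (st k i) j = set xs"
proof (cases "j = i")
  case True
  then show thesis using that EqWait_mcast[OF assms] by blast
next
  case False
  have "prefix (vals (rcv k j i)) (mcast k j)"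
    using mcast_snt rcv_prefix_snt prefix_vals prefix_order.trans by metis
  then show thesis using that V_other[OF False] by blast
qed

section \<open>Views of good Lattice operations\<close>

definition good :: "nat \<Rightarrow> 'n \<Rightarrow> nat \<Rightarrow> ('n, 'v) stamped set \<Rightarrow> bool" where
  "good k i r W \<longleftrightarrow> i \<notin> X k \<and> (\<exists>op p. ctrl (st k i) = EqWait op p r) \<and>
     EQ f (\<lambda>j. tag_le r (V (st k i) j)) i \<and> maxTag (st k i) \<le> r \<and> W = tag_le r (V (st k i) i)"

lemma good_quorum:
  assumes "good k i r W"
  shows "\<exists>Q. card Q \<ge> CARD('n) - f \<and> (\<forall>j\<in>Q. W = tag_le r (V (st k i) j))"
  using assms unfolding good_def EQ_def by metis

lemma good_same_tag:
  assumes "good k i r W" "good k' i' r W'"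
  shows "W \<subseteq> W' \<or> W' \<subseteq> W"
proof -
  obtain Q where Q: "card Q \<ge> CARD('n) - f" "\<And>j. j \<in> Q \<Longrightarrow> W = tag_le r (V (st k i) j)"
    using good_quorum[OF assms(1)] by blast
  obtain Q' where Q': "card Q' \<ge> CARD('n) - f" "\<And>j. j \<in> Q' \<Longrightarrow> W' = tag_le r (V (st k' i') j)"
    using good_quorum[OF assms(2)] by blast
  obtain j where j: "j \<in> Q" "j \<in> Q'"
    using quorums_meet[OF Q(1) Q'(1)] by blast
  obtain xs where xs: "prefix xs (mcast k j)" "V (st k i) j = set xs"
    using assms(1) EqWait_prefix unfolding good_def by metis
  obtain ys where ys: "prefix ys (mcast k' j)" "V (st k' i') j = set ys"
    using assms(2) EqWait_prefix unfolding good_def by metis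
  have "prefix xs (mcast (max k k') j)" "prefix ys (mcast (max k k') j)"
    using prefix_order.trans[OF xs(1) mcast_mono] prefix_order.trans[OF ys(1) mcast_mono]
    by (simp_all add: max.coboundedI1 max.coboundedI2)
  then have "prefix xs ys \<or> prefix ys xs" by (meson prefix_same_cases)
  then have "V (st k i) j \<subseteq> V (st k' i') j \<or> V (st k' i') j \<subseteq> V (st k i) j"
    using xs ys set_mono_prefix by metis
  then show ?thesis using Q(2)[OF j(1)] Q'(2)[OF j(2)] tag_le_mono by metis
qed

lemma V_mcast: "V (st k i) j \<subseteq> set (mcast k j)"
  using V_own_mcast[of k i] snt_mcast[of _ k j i] prefix_in_set[OF rcv_prefix_snt[of k j i]]
  by (cases "j = i") (auto simp: V_other)

lemma acked_V:
  assumes "acked k i l q r t" "k' \<le> t" "x \<in> V (st k' j) l"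
  shows "x \<in> V (st k i) i"
  using assms acked_mcast V_mcast mcast_mono[OF assms(2)] prefix_in_set by (metis subsetD)

lemma good_ackers:
  assumes "good k i r W"
  obtains A where "card A \<ge> CARD('n) - f"
    "\<And>l. l \<in> A \<Longrightarrow> \<exists>t. acked k i l (req (st k i)) r t \<and> start k i < t"
proof -
  from assms obtain op p where *: "i \<notin> X k" "ctrl (st k i) = EqWait op p r"
    unfolding good_def by blast
  from EqWait_write_quorum[OF *(2)] obtain A where
    "card A \<ge> CARD('n) - f" "\<And>l. l \<in> A \<Longrightarrow> WriteAck (req (st k i)) r \<in> set (rcv k l i)"
    unfolding write_quorum_def by blast
  then show thesis using that * acked_after_start write_ack_origin by metis
qed

text \<open>Here the order in time replaces a strictly larger tag, so equal tags are covered: the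
  common member has forwarded \<open>W\<close> before the second operation is invoked, hence before
  it acknowledges \<open>r'\<close>.\<close>

lemma good_later:
  assumes "good k i r W" "good k' i' r' W'" "r \<le> r'" "k \<le> start k' i'"
  shows "W \<subseteq> W'"
proof -
  obtain Q where Q: "card Q \<ge> CARD('n) - f" "\<And>j. j \<in> Q \<Longrightarrow> W = tag_le r (V (st k i) j)"
    using good_quorum[OF assms(1)] by blast
  obtain A where A: "card A \<ge> CARD('n) - f"
    "\<And>l. l \<in> A \<Longrightarrow> \<exists>t. acked k' i' l (req (st k' i')) r' t \<and> start k' i' < t"
    using assms(2) by (rule good_ackers) auto
  obtain l where l: "l \<in> Q" "l \<in> A"
    using quorums_meet[OF Q(1) A(1)] by blast
  obtain t where t: "acked k' i' l (req (st k' i')) r' t" "start k' i' < t"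
    using A l by blast
  then have "V (st k i) l \<subseteq> V (st k' i') i'"
    using acked_V[OF t(1), of k] assms(4) by auto
  moreover have "W = tag_le r (V (st k i) l)" "W' = tag_le r' (V (st k' i') i')"
    using Q l assms(2) unfolding good_def by blast+
  ultimately show ?thesis using assms(3) by (auto simp: tag_le_def)
qed

text \<open>A sending step without \<open>ok\<close> would have crashed \<open>l\<close>, which is
  still alive at \<open>k'\<close>; so \<open>l\<close> has really processed the request.\<close>

lemma acked_ok:
  assumes "acked k i l q r t" "l \<notin> X k'" "t < k'"
  shows "ok t" "r \<le> maxTag (st k' l)"
proof -
  have "out t \<noteq> []"
    using assms(1) unfolding acked_def by (auto simp: snt.simps)
  then show "ok t"
    using assms not_ok_crashes[of t] crashed_mono[of "Suc t" k'] unfolding acked_def by auto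
  then have "WriteTag q r \<in> set (rcv (Suc t) i l)"
    using assms(1) unfolding acked_def by blast
  then have "r \<le> maxTag (st (Suc t) l)" using tag_received by blast
  then show "r \<le> maxTag (st k' l)"
    using frame_mono(2)[of "Suc t" k' l] assms(3) by simp
qed

text \<open>
  A node that lags behind the tag \<open>r'\<close> has not yet received \<open>EchoTag r'\<close> from the common
  member of the two quorums. So what it has received from there was sent before the
  acknowledgement of \<open>r'\<close>.
\<close>

lemma good_larger_tag:
  assumes "good k i r W" "good k' i' r' W'" "r < r'"
  shows "W \<subseteq> W'"
proof -
  obtain Q where Q: "card Q \<ge> CARD('n) - f" "\<And>j. j \<in> Q \<Longrightarrow> W = tag_le r (V (st k i) j)"
    using good_quorum[OF assms(1)] by blast
  obtain A where A: "card A \<ge> CARD('n) - f"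
    "\<And>l. l \<in> A \<Longrightarrow> \<exists>t. acked k' i' l (req (st k' i')) r' t \<and> start k' i' < t"
    using assms(2) by (rule good_ackers) auto
  obtain l where l: "l \<in> Q" "l \<in> A"
    using quorums_meet[OF Q(1) A(1)] by blast
  obtain t where t: "acked k' i' l (req (st k' i')) r' t"
    using A l by blast
  have lag: "maxTag (st k i) < r'" and alive: "i \<notin> X k"
    using assms unfolding good_def by auto
  have "V (st k i) l \<subseteq> set (mcast t l)"
  proof (cases "l = i")
    case True
    \<comment> \<open>The echo to itself may still be under way, but a node raises its own
      \<open>maxTag\<close> already when it acknowledges \<open>r'\<close>.\<close>
    then have "k \<le> t" using acked_ok(2)[OF t] lag alive by (meson not_less)
    then show ?thesis using V_mcast mcast_mono set_mono_prefix by (metis subset_trans)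
  next
    case False
    let ?m = "max k (Suc t)"
    have "prefix (rcv k l i) (snt ?m l i)"
      using prefix_order.trans[OF rcv_prefix_snt snt_mono] by simp
    moreover have "prefix (snt t l i @ [EchoTag r']) (snt (Suc t) l i)"
      using t unfolding acked_def by blast
    then have "prefix (snt t l i @ [EchoTag r']) (snt ?m l i)"
      using prefix_order.trans[OF _ snt_mono] by simp
    ultimately consider "prefix (snt t l i @ [EchoTag r']) (rcv k l i)"
      | "prefix (rcv k l i) (snt t l i @ [EchoTag r'])"
      using prefix_same_cases by blast
    then have "prefix (rcv k l i) (snt t l i)"
    proof cases
      case 1
      then have "EchoTag r' \<in> set (rcv k l i)" by (auto simp: prefix_def)
      then show ?thesis using tag_received lag by (meson not_less)
    next
      case 2
      moreover have "rcv k l i \<noteq> snt t l i @ [EchoTag r']"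
        using tag_received[of r' k l i] lag by auto
      ultimately show ?thesis by simp
    qed
    then show ?thesis
      using V_other[OF False] snt_mcast[of _ t l i] by (auto dest: prefix_in_set)
  qed
  then have "V (st k i) l \<subseteq> V (st k' i') i'"
    using acked_mcast t by blast
  moreover have "W = tag_le r (V (st k i) l)" "W' = tag_le r' (V (st k' i') i')"
    using Q l assms(2) unfolding good_def by blast+
  ultimately show ?thesis using assms(3) by (auto simp: tag_le_def)
qed

lemma good_chain: "good k i r W \<Longrightarrow> good k' i' r' W' \<Longrightarrow> W \<subseteq> W' \<or> W' \<subseteq> W"
  using good_same_tag good_larger_tag by (metis linorder_neqE_nat)

section \<open>Tags written to a quorum\<close>

lemma start_same: "k \<le> k' \<Longrightarrow> start k' i < k \<Longrightarrow> start k' i = start k i"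
proof (induction k' rule: dec_induct)
  case (step m)
  then show ?case by (auto simp: start.simps split: if_splits)
qed simp

text \<open>Crashed nodes count as members of the quorum: they do not answer later requests.\<close>

definition written :: "nat \<Rightarrow> nat \<Rightarrow> bool" where
  "written k r \<longleftrightarrow> (\<exists>A. card A \<ge> CARD('n) - f \<and> (\<forall>l\<in>A. l \<notin> X k \<longrightarrow> r \<le> maxTag (st k l)))"

lemma written_mono: "written k r \<Longrightarrow> k \<le> k' \<Longrightarrow> written k' r"
  unfolding written_def using alive_earlier frame_mono(2) order.trans by meson

lemma EqWait_written:
  assumes "ctrl (st k i) = EqWait op p r"
  shows "written k r"
proof -
  from EqWait_write_quorum[OF assms] obtain A where
    A: "card A \<ge> CARD('n) - f" "\<And>l. l \<in> A \<Longrightarrow> WriteAck (req (st k i)) r \<in> set (rcv k l i)"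
    unfolding write_quorum_def by blast
  have "r \<le> maxTag (st k l)" if "l \<in> A" "l \<notin> X k" for l
  proof -
    from A(2)[OF that(1)] obtain t where t: "acked k i l (req (st k i)) r t"
      by (rule write_ack_origin)
    then have "t < k" unfolding acked_def by blast
    then show ?thesis using acked_ok(2)[OF t that(2)] by simp
  qed
  then show ?thesis unfolding written_def using A(1) by blast
qed

lemma good_written: "good k i r W \<Longrightarrow> written k r"
  unfolding good_def using EqWait_written by blast

text \<open>Each \<open>ReadTag q\<close> is sent at most once on a channel, so it is answered once.
  This makes the number of recorded read acknowledgements the number of their senders.\<close>

lemma read_ack_inj:
  assumes "i \<notin> X k" "ReadAck q r \<in> set (rcv k l i)" "ReadAck q r' \<in> set (rcv k l i)"
  shows "r = r'"
proof -
  obtain t ms where t: "t < k" "l \<notin> X t" "chan (C t) i l = ReadTag q # ms"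
    "r = maxTag (st t l)" "\<And>k'. t < k' \<Longrightarrow> l \<notin> X k' \<Longrightarrow> ReadTag q \<in> set (rcv k' i l)"
    using assms(2) by (rule read_ack_origin) blast
  obtain t' ms' where t': "t' < k" "l \<notin> X t'" "chan (C t') i l = ReadTag q # ms'"
    "r' = maxTag (st t' l)" "\<And>k'. t' < k' \<Longrightarrow> l \<notin> X k' \<Longrightarrow> ReadTag q \<in> set (rcv k' i l)"
    using assms(3) by (rule read_ack_origin) blast
  have once: "ReadTag q \<notin> set (rcv t i l)"
    if "t < k" "l \<notin> X t" "chan (C t) i l = ReadTag q # ms" for t ms
  proof
    assume "ReadTag q \<in> set (rcv t i l)"
    then have "count_list (rcv t i l) (ReadTag q) \<noteq> 0"
      by (simp add: count_list_0_iff)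
    moreover have "prefix (rcv t i l @ [ReadTag q]) (snt k i l)"
      using prefix_order.trans[OF next_message[OF that(2,3)] snt_mono] that(1) by simp
    ultimately have "\<not> count_list (snt k i l) (ReadTag q) \<le> 1"
      by (auto simp: prefix_def)
    then show False using request_kind[OF assms(1)] by blast
  qed
  have "t = t'"
    using once[OF t(1-3)] once[OF t'(1-3)] t(5)[OF _ t'(2)] t'(5)[OF _ t(2)]
    by (meson linorder_neqE_nat)
  then show ?thesis using t t' by simp
qed

lemma read_acks:
  assumes "i \<notin> X k" "ctrl (st k i) = ReadWait op" "(l, r) \<in> acks (st k i)"
  shows "ReadAck (req (st k i)) r \<in> set (rcv k l i)"
proof -
  have "WriteAck (req (st k i)) r \<notin> set (rcv k l i)"
  proof
    assume "WriteAck (req (st k i)) r \<in> set (rcv k l i)"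
    then obtain t where t: "acked k i l (req (st k i)) r t"
      by (rule write_ack_origin)
    then have "t \<le> k" unfolding acked_def by simp
    then have "WriteTag (req (st k i)) r \<in> set (snt k i l)"
      using acked_request[OF t] snt_mono prefix_snocD prefix_in_set by metis
    then show False using request_kind[OF assms(1)] assms(2) by metis
  qed
  then show ?thesis using acks_received assms(3) by blast
qed

text \<open>The common member answers after the invocation. So it was alive at the invocation, and
  the tag it had then can only have grown.\<close>

lemma read_lower_bound:
  assumes "i \<notin> X k" "ctrl (st k i) = ReadWait op" "card (acks (st k i)) \<ge> CARD('n) - f"
    "written (start k i) r"
  shows "r \<le> Max (snd ` acks (st k i))"
proof -
  note acks = read_acks[OF assms(1,2)]
  obtain A where A: "card A \<ge> CARD('n) - f"
    "\<And>l. l \<in> A \<Longrightarrow> l \<notin> X (start k i) \<Longrightarrow> r \<le> maxTag (st (start k i) l)"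
    using assms(4) unfolding written_def by blast
  have "inj_on fst (acks (st k i))"
    using acks read_ack_inj[OF assms(1)] unfolding inj_on_def by (metis prod.collapse)
  then have "card (fst ` acks (st k i)) \<ge> CARD('n) - f"
    using assms(3) by (simp add: card_image)
  then obtain l where l: "l \<in> A" "l \<in> fst ` acks (st k i)"
    using quorums_meet[OF A(1)] by blast
  then obtain r' where r': "(l, r') \<in> acks (st k i)" by auto
  obtain t ms where t: "t < k" "l \<notin> X t" "chan (C t) i l = ReadTag (req (st k i)) # ms"
    "r' = maxTag (st t l)"
    using acks[OF r'] by (rule read_ack_origin) blast
  have "ReadTag (req (st k i)) \<in> set (snt t i l)"
    using next_message[OF t(2,3)] prefix_snocD by metis
  then have "start k i \<le> t"
    using request_after_start[OF assms(1), of op t l] assms(2) t(1) by simp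
  then have "r \<le> r'"
    using A(2)[OF l(1)] alive_earlier[OF t(2)] frame_mono(2)[of "start k i" t l] t(4)
    by (metis order.trans)
  also have "r' \<le> Max (snd ` acks (st k i))"
  proof (rule Max_ge)
    have "card (acks (st k i)) > 0" using assms(3) quorum_pos by simp
    then show "finite (snd ` acks (st k i))" by (simp add: card_gt_0_iff)
    show "r' \<in> snd ` acks (st k i)" using r' by force
  qed
  finally show ?thesis .
qed

text \<open>Waiting for \<open>GoodLA\<close> counts as a phase after 3, so that what holds from
  phase 2 on carries over to it. For control states without a tag, 0 is a dummy.\<close>

fun phase_of :: "'v control \<Rightarrow> nat" where
  "phase_of (WriteWait op p r) = p"
| "phase_of (EqWait op p r) = p"
| "phase_of (GoodWait op r) = 4"
| "phase_of _ = 0"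

text \<open>The tag that was read may equal \<open>r0\<close>; each retry strictly increases it. The
  strict bound is what a borrowing operation relies on.\<close>

lemma tag_lower_bound:
  "tag_of (ctrl (st k i)) = Some r \<Longrightarrow> written (start k i) r0 \<Longrightarrow>
   r0 \<le> r \<and> (phase_of (ctrl (st k i)) \<ge> 2 \<longrightarrow> r0 < r)"
proof (induction k arbitrary: r)
  case 0
  then show ?case by (simp add: initial init_config_def init_node_def)
next
  case (Suc k)
  show ?case
  proof (cases "ok k \<and> act k = i")
    case False
    then show ?thesis using Suc by (simp add: unchanged)
  next
    case True
    then have "ok k" by simp
    then show ?thesis
    proof (cases rule: act_cases)
      case (invoke op)
      then show ?thesis using Suc True by simp
    next
      case (advance res)
      have alive: "i \<notin> X k" using True ok_step by blast
      have w: "written (start k i) r0" using Suc.prems advance(4) True by simp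
      from advance(1) show ?thesis
        using Suc.prems(1) Suc.IH[OF _ w] True read_lower_bound[OF alive _ _ w]
        by cases (fastforce simp: begin_lattice_def)+
    next
      case (deliver j m ms)
      then show ?thesis
        using Suc True handle_frame[of i j m "st k i"] by simp
    qed
  qed
qed

text \<open>With \<open>start\<close> unchanged there is no new invocation in between, so
  \<open>Idle\<close> means that the operation has returned, and then it stays so.\<close>

lemma tag_mono:
  assumes "k \<le> k'" "start k' i = start k i" "start k i < k"
    "ctrl (st k i) = Idle \<or> (\<exists>r'\<ge>r. tag_of (ctrl (st k i)) = Some r')"
  shows "ctrl (st k' i) = Idle \<or> (\<exists>r'\<ge>r. tag_of (ctrl (st k' i)) = Some r')"
  using assms(1,2)
proof (induction k' rule: dec_induct)
  case base
  then show ?case using assms(4) by simp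
next
  case (step m)
  show ?case
  proof (cases "ok m \<and> act m = i")
    case False
    then show ?thesis using step by (simp add: unchanged)
  next
    case True
    then have "ok m" by simp
    then show ?thesis
    proof (cases rule: act_cases)
      case (invoke op)
      then have "start k i = m" using step True by simp
      then show ?thesis using assms(3) step by simp
    next
      case (advance res)
      then have "start m i = start k i" using step True by simp
      then have IH: "ctrl (st m i) = Idle \<or> (\<exists>r'\<ge>r. tag_of (ctrl (st m i)) = Some r')"
        using step by simp
      from advance(1) show ?thesis
        using IH True by cases (auto simp: begin_lattice_def)
    next
      case (deliver j m ms)
      then show ?thesis
        using step True handle_frame[of i j m] by simp
    qed
  qed
qed


lemma start_less: "ctrl (st k i) = EqWait op p r \<Longrightarrow> start k i < k"
  using op_of_start[of k i op] by simp

text \<open>Within one operation tags grow; between operations, the earlier tag has been written to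
  a quorum before the later invocation, whose read finds it.\<close>

lemma good_tag_mono:
  assumes "good k i r W" "good k' i r' W'" "k \<le> k'"
  shows "r \<le> r'"
proof -
  obtain op p op' p' where *: "ctrl (st k i) = EqWait op p r" "ctrl (st k' i) = EqWait op' p' r'"
    using assms unfolding good_def by blast
  show ?thesis
  proof (cases "start k' i < k")
    case True
    then have "start k' i = start k i" using start_same assms(3) by simp
    then show ?thesis using tag_mono[of k k' i r] * assms(3) start_less by auto
  next
    case False
    then have "written (start k' i) r" using good_written[OF assms(1)] written_mono by simp
    then show ?thesis using tag_lower_bound[of k' i r' r] * by simp
  qed
qed

section \<open>Borrowed views\<close>

lemma GoodLA_origin:
  assumes "prefix (us @ [GoodLA r]) (snt k j i)"
  obtains t W where "t < k" "act t = j" "us = snt t j i" "good t j r W"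
    "\<And>k'. t < k' \<Longrightarrow> j \<notin> X k' \<Longrightarrow> ok t \<and> (UNIV, GoodLA r) \<in> set (out t)"
proof -
  from snt_origin[OF assms] obtain t xs ys where
    t: "t < k" "act t = j" "us = snt t j i @ xs" "msgs i (out t) = xs @ GoodLA r # ys"
    by blast
  then have "GoodLA r \<in> set (msgs i (out t))" by simp
  then obtain A where A: "i \<in> A" "(A, GoodLA r) \<in> set (out t)"
    unfolding msgs_in_sends by blast
  from A(2) show thesis
  proof (rule sent_in_out)
    fix B outs
    assume *: "act t \<notin> X t" "A \<subseteq> B" "sent_in f (act t) (C t) outs B (GoodLA r)"
      "out t = outs \<or> \<not> ok t \<and> interrupted outs (out t)"
    then obtain vs where vs: "outs = (UNIV, GoodLA r) # vs" "\<forall>B. (B, GoodLA r) \<notin> set vs"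
      by auto
    have g: "good t j r (tag_le r (V (st t j) j))"
      unfolding good_def using * t by auto
    obtain B' vs' where vs': "out t = (B', GoodLA r) # vs'" "\<forall>B. (B, GoodLA r) \<notin> set vs'"
      "ok t \<longrightarrow> B' = UNIV"
      using *(4) vs interrupted_subset[of vs] by (auto simp: interrupted_Cons) blast
    have "GoodLA r \<notin> set (msgs i vs')" using vs' unfolding msgs_in_sends by blast
    \<comment> \<open>In its step \<open>GoodLA r\<close> comes first and only once. So what
      precedes it on the channel is exactly what was sent up to the good moment.\<close>
    then have "xs = []"
      using t(4) vs' by (auto simp: Cons_eq_append_conv split: if_splits)
    moreover have "ok t" if "t < k'" "j \<notin> X k'" for k'
      using that t vs' not_ok_crashes[of t] crashed_mono[of "Suc t" k'] by fastforce
    ultimately show thesis using that[of t] t g vs' by simp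
  qed
qed

lemma goods_received: "(j, r) \<in> goods (st k i) \<Longrightarrow> GoodLA r \<in> set (rcv k j i)"
proof (induction k)
  case 0
  then show ?case by (simp add: initial init_config_def init_node_def)
next
  case (Suc k)
  show ?case
  proof (cases "ok k \<and> act k = i")
    case False
    then show ?thesis using Suc by (simp add: unchanged)
  next
    case True
    then have "ok k" by simp
    then show ?thesis
    proof (cases rule: act_cases)
      case (invoke op)
      then show ?thesis using Suc True by simp
    next
      case (advance res)
      then show ?thesis using Suc True advance_frame[OF advance(1)] by simp
    next
      case (deliver l m ms)
      have rcv: "rcv (Suc k) l' i = rcv k l' i @ (if l' = l then [m] else [])" for l'
        using deliver(5,6) True by auto
      show ?thesis
        using deliver(3) Suc True by (cases m) (auto simp: rcv split: if_splits)
    qed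
  qed
qed

text \<open>By FIFO, when \<open>GoodLA r'\<close> arrives the receiver's entry for \<open>j\<close>
  consists of all values that \<open>j\<close> had multicast at the good moment, and in
  \<open>EqWait\<close> these are the own entry of \<open>j\<close>. Later announcements overwrite
  the view, but by \<open>good_tag_mono\<close> never with a smaller tag.\<close>

lemma D_good:
  assumes "j \<noteq> i" "GoodLA r \<in> set (rcv k j i)"
  shows "\<exists>t<k. \<exists>r'\<ge>r. good t j r' (D (st k i) j)"
  using assms(2)
proof (induction k arbitrary: r)
  case (Suc k)
  have keep: ?case if "D (st (Suc k) i) j = D (st k i) j" "GoodLA r \<in> set (rcv k j i)"
  proof -
    from Suc.IH[OF that(2)] obtain t r' where "t < k" "r' \<ge> r" "good t j r' (D (st k i) j)"
      by blast
    then show ?thesis using that(1) by (metis less_SucI)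
  qed
  show ?case
  proof (cases "ok k \<and> act k = i")
    case False
    then show ?thesis using keep Suc.prems by (simp add: unchanged)
  next
    case True
    then have "ok k" by simp
    then show ?thesis
    proof (cases rule: act_cases)
      case (invoke op)
      then show ?thesis using keep Suc.prems True by simp
    next
      case (advance res)
      then show ?thesis using keep Suc.prems True advance_frame[OF advance(1)] by simp
    next
      case (deliver l m ms)
      have rcv: "rcv (Suc k) j i = rcv k j i @ (if j = l then [m] else [])"
        using deliver(5,6) True by auto
      have alive: "i \<notin> X k" using True ok_step by blast
      show ?thesis
      proof (cases "j = l \<and> (\<exists>r'. m = GoodLA r')")
        case False
        then have "D (st (Suc k) i) j = D (st k i) j" "GoodLA r \<in> set (rcv k j i)"
          using deliver(3) Suc.prems True by (cases m; auto simp: rcv split: if_splits)+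
        then show ?thesis by (rule keep)
      next
        case True
        then obtain r' where r': "m = GoodLA r'" "l = j" by blast
        have "prefix (rcv k j i @ [GoodLA r']) (snt k j i)"
          using next_message[OF alive] deliver(2) r' \<open>ok k \<and> act k = i\<close> by simp
        then obtain t W where t: "t < k" "rcv k j i = snt t j i" "good t j r' W"
          by (rule GoodLA_origin)
        then have "V (st t j) j = set (mcast t j)" "vals (snt t j i) = mcast t j"
          unfolding good_def using EqWait_mcast mcast_snt by blast+
        moreover have "V (st k i) j = set (vals (snt t j i))"
          using V_other[OF assms(1)] t by simp
        ultimately have "W = tag_le r' (V (st k i) j)"
          using t(3) unfolding good_def by simp
        then have "good t j r' (D (st (Suc k) i) j)"
          using t(3) deliver(3) r' \<open>ok k \<and> act k = i\<close> by simp
        moreover have "r \<le> r'"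
        proof (cases "GoodLA r \<in> set (rcv k j i)")
          case False
          then show ?thesis using Suc.prems rcv r' by simp
        next
          case True
          then obtain us vs where us: "snt t j i = us @ GoodLA r # vs"
            using t(2) by (metis split_list)
          then have "prefix (us @ [GoodLA r]) (snt t j i)" by simp
          then obtain t0 W0 where "t0 < t" "good t0 j r W0"
            by (rule GoodLA_origin)
          then show ?thesis using good_tag_mono[OF _ t(3)] by simp
        qed
        ultimately show ?thesis using less_SucI[OF t(1)] by blast
      qed
    qed
  qed
qed simp

text \<open>
  A node may receive other values between sending and receiving its own \<open>GoodLA r\<close>, so its own
  entry of \<open>D\<close> need not be a view. It is never borrowed.
\<close>

lemma no_own_borrow:
  assumes "i \<notin> X k" "ctrl (st k i) = GoodWait op r"
  shows "GoodLA r \<notin> set (rcv k i i)"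
proof
  assume "GoodLA r \<in> set (rcv k i i)"
  then have "GoodLA r \<in> set (snt k i i)" using rcv_prefix_snt prefix_in_set by metis
  then obtain us vs where "snt k i i = us @ GoodLA r # vs" by (metis split_list)
  then have "prefix (us @ [GoodLA r]) (snt k i i)" by simp
  then obtain t W where t: "t < k" "act t = i" "good t i r W"
    "ok t" "(UNIV, GoodLA r) \<in> set (out t)"
    using assms(1) by (elim GoodLA_origin) blast
  \<comment> \<open>If \<open>GoodLA r\<close> was sent before the invocation, the tag after three
    phases is above \<open>r\<close>. If the current operation sent it, this either ended the
    operation or happened in phase 0, and phase 1 then started with a tag of at least
    \<open>r + 1\<close>.\<close>
  show False
  proof (cases "start k i < t")
    case False
    then have "written (start k i) r" using good_written[OF t(3)] written_mono by simp
    then show False using tag_lower_bound[of k i r r] assms(2) by simp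
  next
    case True
    then have start: "start k i = start t i" using start_same t(1) by simp
    note out = t(5)
    from \<open>ok t\<close> have *: "start (Suc t) i = start t i \<and>
      (ctrl (st (Suc t) i) = Idle \<or> (\<exists>r'\<ge>Suc r. tag_of (ctrl (st (Suc t) i)) = Some r'))"
    proof (cases rule: act_cases)
      case (invoke op)
      then show ?thesis using out by simp
    next
      case (advance res)
      from advance(1) show ?thesis
        using out advance(4) t(2) by cases (auto simp: begin_lattice_def write_tag_def split: if_splits)
    next
      case (deliver j m ms)
      then show ?thesis using out by (cases m) (auto split: if_splits)
    qed
    have "ctrl (st k i) = Idle \<or> (\<exists>r'\<ge>Suc r. tag_of (ctrl (st k i)) = Some r')"
      using * start t(1) start_le[of t i] by (intro tag_mono[of "Suc t" k i "Suc r"]) (linarith | blast)+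
    then show False using assms(2) by simp
  qed
qed

section \<open>Values of UPDATE operations\<close>

text \<open>The step may be a crash in the middle of the multicast. Such an UPDATE never completes,
  but other nodes may see its value, so it needs its place in the linearization.\<close>

definition stamping :: "nat \<Rightarrow> ('n, 'v) stamped \<Rightarrow> bool" where
  "stamping k x \<longleftrightarrow> act k \<notin> X k \<and> Value x \<in> snd ` set (out k) \<and>
     (\<exists>v. ctrl (st k (act k)) = ReadWait (Update v) \<and> card (acks (st k (act k))) \<ge> CARD('n) - f \<and>
        x = (v, Max (snd ` acks (st k (act k))) + 1, act k))"

definition stamped :: "nat \<Rightarrow> ('n, 'v) stamped \<Rightarrow> bool" where
  "stamped a x \<longleftrightarrow> (\<exists>k. stamping k x \<and> start k (act k) = a)"

text \<open>A forwarded value was received, hence multicast earlier; tracing it back ends at the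
  UPDATE that created its timestamp.\<close>

lemma mcast_stamping: "x \<in> set (mcast k j) \<Longrightarrow> \<exists>t<k. stamping t x"
proof (induction k arbitrary: j)
  case (Suc k)
  show ?case
  proof (cases "x \<in> set (mcast k j)")
    case True
    then show ?thesis using Suc.IH less_SucI by blast
  next
    case False
    then have "Value x \<in> snd ` set (out k)"
      using Suc.prems by (auto simp: mcast.simps split: if_splits)
    then obtain A where "(A, Value x) \<in> set (out k)" by auto
    then show ?thesis
    proof (rule sent_in_out)
      fix B outs
      assume *: "act k \<notin> X k" "sent_in f (act k) (C k) outs B (Value x)"
      show ?thesis
      proof (cases "\<exists>l ms. chan (C k) l (act k) = Value x # ms")
        case True
        then obtain l ms where "chan (C k) l (act k) = Value x # ms" by blast
        then have "Value x \<in> set (snt k l (act k))"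
          using next_message[OF *(1)] prefix_snocD by metis
        then show ?thesis using snt_mcast Suc.IH less_SucI by blast
      next
        case False
        then have "stamping k x"
          unfolding stamping_def using * \<open>Value x \<in> snd ` set (out k)\<close> by auto
        then show ?thesis by blast
      qed
    qed
  qed
qed simp

lemma stamping_update:
  assumes "stamping k x"
  shows "start k (act k) < k \<and> ok (start k (act k)) \<and> (\<exists>t. x = (fst x, t, act k)) \<and>
    ev (start k (act k)) = Invoke (act k) (Update (fst x))"
  using assms op_of_start[of k "act k" "Update (fst x)"] unfolding stamping_def by auto

lemma stamping_step:
  assumes "stamping k x" "ok k"
  obtains v r where "x = (v, r + 1, act k)" "ctrl (st k (act k)) = ReadWait (Update v)"
    "r = Max (snd ` acks (st k (act k)))"
    "ctrl (st (Suc k) (act k)) = WriteWait (Update v) 0 r" "start (Suc k) (act k) = start k (act k)"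
proof -
  from assms(1) obtain v where v: "ctrl (st k (act k)) = ReadWait (Update v)"
    "x = (v, Max (snd ` acks (st k (act k))) + 1, act k)" "card (acks (st k (act k))) \<ge> CARD('n) - f"
    unfolding stamping_def by blast
  from assms(2) show thesis
  proof (cases rule: act_cases)
    case (invoke op)
    then show ?thesis using v by simp
  next
    case (advance res)
    from advance(1) show ?thesis
      using v advance(4) by cases (auto simp: begin_lattice_def intro: that)
  next
    case (deliver j m ms)
    \<comment> \<open>A delivery requires a blocked program, but with enough acknowledgements this
      one can proceed.\<close>
    then show ?thesis using advance.update_read[OF v(1,3) refl] by blast
  qed
qed

text \<open>After stamping, the operation has a tag until it returns, so by \<open>tag_mono\<close>
  it is never again in \<open>ReadWait\<close>.\<close>

lemma stamping_once:
  assumes "stamping k x" "stamping k' y" "act k = act k'" "start k (act k) = start k' (act k)" "k < k'"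
  shows False
proof -
  have "act k \<notin> X k'" using assms unfolding stamping_def by simp
  moreover have "out k \<noteq> []" using assms(1) unfolding stamping_def by auto
  ultimately have "ok k"
    using not_ok_crashes[of k] crashed_mono[of "Suc k" k'] assms(5) by fastforce
  with assms(1) obtain v r where *: "ctrl (st (Suc k) (act k)) = WriteWait (Update v) 0 r"
    "start (Suc k) (act k) = start k (act k)"
    by (rule stamping_step)
  have "start (Suc k) (act k) < Suc k" using * start_le[of k "act k"] by simp
  then have "ctrl (st k' (act k)) = Idle \<or> (\<exists>r'\<ge>r. tag_of (ctrl (st k' (act k))) = Some r')"
    using * assms(4,5) by (intro tag_mono[of "Suc k" k' "act k" r]) auto
  then show False using assms(2,3) unfolding stamping_def by auto
qed

lemma stamped_unique:
  assumes "stamped a x" "stamped a y"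
  shows "x = y"
proof -
  obtain k k' where *: "stamping k x" "start k (act k) = a" "stamping k' y" "start k' (act k') = a"
    using assms unfolding stamped_def by blast
  then have "act k = act k'" using stamping_update[of k] stamping_update[of k'] by simp
  then have "k = k'"
    using * stamping_once[of k x k' y] stamping_once[of k' y k x] by (metis linorder_neqE_nat)
  then show ?thesis using * unfolding stamping_def by auto
qed

lemma stamped_lower_bound:
  assumes "stamped a (v, t, i)" "written a r"
  shows "r < t"
proof -
  obtain k where k: "stamping k (v, t, i)" "start k (act k) = a"
    using assms unfolding stamped_def by blast
  then show ?thesis
    using read_lower_bound[of "act k" k _ r] assms(2) unfolding stamping_def by fastforce
qed

lemma good_stamped:
  assumes "good k i r W" "x \<in> W"
  obtains t where "t < k" "stamping t x"
  using assms V_mcast mcast_stamping unfolding good_def by (meson subsetD tag_le_subset)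

lemma good_mono: "good k i r W \<Longrightarrow> (v, t, j) \<in> W \<Longrightarrow> t \<le> r"
  unfolding good_def by auto

text \<open>
  In phase 0 of an UPDATE, a common member \<open>l\<close> of two write quorums either got the new value
  before the larger tag \<open>r'\<close>, and then forwarded it before acknowledging \<open>r'\<close>, or echoed \<open>r'\<close>
  before acknowledging phase 0. The latter makes the next tag of the UPDATE at least \<open>r'\<close>.
\<close>

lemma update_seen:
  assumes "i \<notin> X k" "ctrl (st k i) = EqWait (Update v) 0 r"
    and "good k' j r' W" "max (r + 1) (maxTag (st k i)) < r'"
  shows "(v, r + 1, i) \<in> W"
proof -
  obtain A where A: "card A \<ge> CARD('n) - f"
    "\<And>l. l \<in> A \<Longrightarrow> WriteAck (req (st k i)) r \<in> set (rcv k l i)"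
    using EqWait_write_quorum[OF assms(2)] unfolding write_quorum_def by blast
  obtain B where B: "card B \<ge> CARD('n) - f"
    "\<And>l. l \<in> B \<Longrightarrow> \<exists>t. acked k' j l (req (st k' j)) r' t \<and> start k' j < t"
    using assms(3) by (rule good_ackers) auto
  obtain l where l: "l \<in> A" "l \<in> B"
    using quorums_meet[OF A(1) B(1)] by blast
  obtain s where s: "acked k i l (req (st k i)) r s"
    using A(2)[OF l(1)] by (rule write_ack_origin)
  obtain t where t: "acked k' j l (req (st k' j)) r' t"
    using B(2)[OF l(2)] by blast
  have "s \<le> t"
  proof (rule ccontr)
    assume "\<not> s \<le> t"
    then have "prefix (snt (Suc t) l i) (snt s l i)" using snt_mono by simp
    moreover have "EchoTag r' \<in> set (snt (Suc t) l i)"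
      using t prefix_snocD unfolding acked_def by metis
    moreover have "prefix (snt s l i) (rcv k l i)" using s unfolding acked_def by blast
    ultimately have "EchoTag r' \<in> set (rcv k l i)" using prefix_in_set by metis
    then show False using tag_received[of r' k l i] assms(4) by auto
  qed
  moreover have "prefix (rcv s i l @ [WriteTag (req (st k i)) r]) (snt k i l)"
    using prefix_order.trans[OF acked_request[OF s] snt_mono] s unfolding acked_def by simp
  then have "Value (v, r + 1, i) \<in> set (rcv s i l)"
    using request_kind[OF assms(1)] assms(2) precedesD by metis
  then have "(v, r + 1, i) \<in> V (st s l) l" by (auto simp: V_own)
  ultimately have "(v, r + 1, i) \<in> V (st k' j) j" using acked_V[OF t] by blast
  then show ?thesis using assms(3,4) unfolding good_def by simp
qed

text \<open>What each phase knows about the value \<open>x\<close> of a pending UPDATE, with respect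
  to all good operations of the run, past and future. Phase 1 starts with the strict guarantee of
  \<open>update_seen\<close>. A retry raises the tag, which turns it into one that includes equal
  tags, and this form is kept up to borrowing.\<close>

definition own_value_inv :: "nat \<Rightarrow> 'n \<Rightarrow> nat \<Rightarrow> ('n, 'v) stamped \<Rightarrow> bool" where
  "own_value_inv k i r x \<longleftrightarrow> x \<in> set (mcast k i) \<and> stamped (start k i) x \<and>
     (phase_of (ctrl (st k i)) = 0 \<longrightarrow> (\<exists>v. op_of (ctrl (st k i)) = Some (Update v) \<and> x = (v, r + 1, i))) \<and>
     (phase_of (ctrl (st k i)) > 0 \<longrightarrow> fst (snd x) \<le> r) \<and>
     (phase_of (ctrl (st k i)) = 1 \<longrightarrow> (\<forall>k' j r' W. good k' j r' W \<longrightarrow> r < r' \<longrightarrow> x \<in> W)) \<and>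
     (phase_of (ctrl (st k i)) \<ge> 2 \<longrightarrow> (\<forall>k' j r' W. good k' j r' W \<longrightarrow> r \<le> r' \<longrightarrow> x \<in> W))"

lemma own_value_inv_frame:
  assumes "own_value_inv k i r x" "ctrl (st (Suc k) i) = ctrl (st k i)" "start (Suc k) i = start k i"
  shows "own_value_inv (Suc k) i r x"
  using assms prefix_in_set[OF mcast_mono[of k "Suc k" i]] unfolding own_value_inv_def by simp

lemma update_invariant:
  "op_of (ctrl (st k i)) = Some (Update v) \<Longrightarrow> tag_of (ctrl (st k i)) = Some r \<Longrightarrow>
   \<exists>x. own_value_inv k i r x"
proof (induction k arbitrary: r)
  case 0
  then show ?case by (simp add: initial init_config_def init_node_def)
next
  case (Suc k)
  have mcast: "set (mcast k i) \<subseteq> set (mcast (Suc k) i)"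
    using mcast_mono set_mono_prefix by (metis le_SucI order_refl)
  show ?case
  proof (cases "ok k \<and> act k = i")
    case False
    then show ?thesis using Suc own_value_inv_frame[of k i r] by (simp add: unchanged) blast
  next
    case True
    then have "ok k" by simp
    then show ?thesis
    proof (cases rule: act_cases)
      case (invoke op)
      then show ?thesis using Suc True by simp
    next
      case (advance res)
      have alive: "i \<notin> X k" using True ok_step by blast
      note [simp] = begin_lattice_def
      have keep: ?thesis if "op_of (ctrl (st k i)) = Some (Update v)" "tag_of (ctrl (st k i)) = Some r0"
        "\<And>x. own_value_inv k i r0 x \<Longrightarrow> own_value_inv (Suc k) i r x" for r0
        using Suc.IH that by blast
      from advance(1) show ?thesis
      proof cases
        case (update_read v' r')
        then have [simp]: "v' = v" "r' = r" using Suc.prems True by auto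
        have out: "Value (v, r + 1, i) \<in> snd ` set (out k)" using update_read True by force
        have "stamping k (v, r + 1, i)"
          unfolding stamping_def using update_read True alive out by simp
        then have "stamped (start (Suc k) i) (v, r + 1, i)"
          unfolding stamped_def using advance(4) True by auto
        moreover have "(v, r + 1, i) \<in> set (mcast (Suc k) i)"
          using out True by (auto simp: mcast.simps)
        ultimately have "own_value_inv (Suc k) i r (v, r + 1, i)"
          unfolding own_value_inv_def using update_read True by simp
        then show ?thesis by blast
      next
        case (written op p r0)
        then show ?thesis
          using Suc.prems True advance(4) mcast by (intro keep[of r]) (auto simp: own_value_inv_def)
      next
        case (lattice_phase0 op r0 r')
        then have op: "ctrl (st k i) = EqWait (Update v) 0 r0" "r = max (r0 + 1) (maxTag (st k i))"
          using Suc.prems True by auto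
        show ?thesis
        proof (rule keep)
          fix x assume x: "own_value_inv k i r0 x"
          then have "x = (v, r0 + 1, i)" using op unfolding own_value_inv_def by simp
          then show "own_value_inv (Suc k) i r x"
            using x update_seen[OF alive op(1)] lattice_phase0 op advance(4) mcast True
            unfolding own_value_inv_def by auto
        qed (use op in auto)
      next
        case (lattice_retry op p r0)
        then have "p = 1 \<or> p = 2" "r0 < r" "ctrl (st k i) = EqWait (Update v) p r0"
          "ctrl (st (Suc k) i) = WriteWait (Update v) (Suc p) r"
          using Suc.prems True by auto
        then show ?thesis
          using advance(4) mcast True
          by (intro keep[of r0]) (auto simp: own_value_inv_def)
      next
        case (lattice_give_up op r0)
        then show ?thesis
          using Suc.prems True advance(4) mcast by (intro keep[of r]) (auto simp: own_value_inv_def)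
      qed (use Suc.prems True in auto)
    next
      case (deliver j m ms)
      then have "ctrl (st (Suc k) i) = ctrl (st k i)" "start (Suc k) i = start k i"
        using True handle_frame[of i j m "st k i"] by simp_all
      then show ?thesis using Suc own_value_inv_frame[of k i r] by simp blast
    qed
  qed
qed

section \<open>Linearization\<close>

text \<open>If the node's own Lattice succeeds, its tag may equal that of a view from before the
  invocation, and \<open>good_later\<close> decides by time. For a borrowed view time is no help,
  because the lender may have been invoked earlier; but there the tag is strictly larger and
  \<open>good_larger_tag\<close> applies.\<close>

lemma completed_view:
  assumes "ok m" "ev m = Return i y"
  obtains op W k j t where "start m i < m" "ok (start m i)" "ev (start m i) = Invoke i op"
    "y = respond init op W" "k \<le> m" "good k j t W"
    "\<And>k' j' t' W'. good k' j' t' W' \<Longrightarrow> k' \<le> start m i \<Longrightarrow> W' \<subseteq> W"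
    "\<And>v. op = Update v \<Longrightarrow> \<exists>x. stamped (start m i) x \<and> x \<in> W"
  using assms(1)
proof (cases rule: act_cases)
  case (invoke op)
  then show ?thesis using assms by simp
next
  case (deliver j m ms)
  then show ?thesis using assms by simp
next
  case (advance res)
  have i: "act m = i" using assms event_of_act by blast
  then have res: "res = Some y" using assms advance(2) by (auto split: option.splits)
  have alive: "i \<notin> X m" using assms ok_step i by blast
  from advance(1) show ?thesis
  proof cases
    case (lattice_good op p r)
    then have ctrl: "ctrl (st m i) = EqWait op p r" and p: "p > 0" using i by auto
    let ?W = "tag_le r (V (st m i) i)"
    have good: "good m i r ?W"
      unfolding good_def using lattice_good i alive by auto
    show ?thesis
    proof (rule that)
      show "start m i < m" "ok (start m i)" "ev (start m i) = Invoke i op"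
        using op_of_start[of m i op] ctrl by auto
      show "y = respond init op ?W" using lattice_good res i by simp
      show "W' \<subseteq> ?W" if "good k' j' t' W'" "k' \<le> start m i" for k' j' t' W'
      proof -
        have "written (start m i) t'" using written_mono[OF good_written[OF that(1)]] that(2) .
        then have "t' \<le> r" using tag_lower_bound[of m i r t'] ctrl by simp
        then show ?thesis using good_later[OF that(1) good] that(2) by blast
      qed
      show "\<exists>x. stamped (start m i) x \<and> x \<in> ?W" if op: "op = Update v" for v
      proof -
        obtain x where x: "own_value_inv m i r x"
          using update_invariant[of m i v r] ctrl op by auto
        then have "x \<in> V (st m i) i" "fst (snd x) \<le> r"
          using p ctrl EqWait_mcast[OF alive ctrl] unfolding own_value_inv_def by auto
        then have "x \<in> ?W" by (cases x) simp
        then show ?thesis using x unfolding own_value_inv_def by blast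
      qed
    qed (use good in auto)
  next
    case (borrow op r j)
    then have ctrl: "ctrl (st m i) = GoodWait op r" using i by simp
    have received: "GoodLA r \<in> set (rcv m j i)"
      using borrow goods_received i by blast
    then have "j \<noteq> i" using no_own_borrow[OF alive ctrl] by blast
    from D_good[OF this received] obtain k t where
      k: "k < m" "r \<le> t" "good k j t (D (st m i) j)" by blast
    show ?thesis
    proof (rule that)
      show "start m i < m" "ok (start m i)" "ev (start m i) = Invoke i op"
        using op_of_start[of m i op] ctrl by auto
      show "y = respond init op (D (st m i) j)" using borrow res i by simp
      show "W' \<subseteq> D (st m i) j" if "good k' j' t' W'" "k' \<le> start m i" for k' j' t' W'
      proof -
        have "written (start m i) t'" using written_mono[OF good_written[OF that(1)]] that(2) .
        then have "t' < r" using tag_lower_bound[of m i r t'] ctrl by simp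
        then show ?thesis using good_larger_tag[OF that(1) k(3)] k(2) by simp
      qed
      show "\<exists>x. stamped (start m i) x \<and> x \<in> D (st m i) j" if op: "op = Update v" for v
      proof -
        obtain x where "own_value_inv m i r x"
          using update_invariant[of m i v r] ctrl op by auto
        then have "stamped (start m i) x" "x \<in> D (st m i) j"
          using k ctrl unfolding own_value_inv_def by auto
        then show ?thesis by blast
      qed
    qed (use k in auto)
  qed (use res in auto)
qed

section \<open>Completed operations and their timestamps\<close>

lemma op_pending:
  assumes "ok a" "ev a = Invoke i op"
  shows "a < k \<Longrightarrow> (start k i = a \<and> ctrl (st k i) \<noteq> Idle) \<or>
    (\<exists>m y. a < m \<and> m < k \<and> ok m \<and> ev m = Return i y \<and> start m i = a)"
proof (induction k)
  case (Suc k)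
  show ?case
  proof (cases "a = k")
    case True
    have "act k = i" using assms True event_of_act by blast
    from assms(1) show ?thesis unfolding True
      by (cases rule: act_cases) (use \<open>act k = i\<close> True assms in \<open>auto split: option.splits\<close>)
  next
    case False
    then consider "start k i = a" "ctrl (st k i) \<noteq> Idle" |
      "\<exists>m y. a < m \<and> m < k \<and> ok m \<and> ev m = Return i y \<and> start m i = a"
      using Suc by fastforce
    then show ?thesis
    proof cases
      case 1
      show ?thesis
      proof (cases "ok k \<and> act k = i")
        case False
        then show ?thesis using 1 by (simp add: unchanged)
      next
        case True
        then have "ok k" by simp
        then show ?thesis
        proof (cases rule: act_cases)
          case (invoke op)
          then show ?thesis using 1 True by simp
        next
          case (deliver j m ms)
          then show ?thesis using 1 True handle_frame[of i j m "st k i"] by simp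
        next
          case (advance res)
          show ?thesis
          proof (cases res)
            case None
            from advance(1) have "ctrl (st (Suc k) i) \<noteq> Idle"
              using None True by cases (auto simp: begin_lattice_def)
            then show ?thesis using 1 True advance(4) by simp
          next
            case (Some y)
            then have "a < k \<and> k < Suc k \<and> ok k \<and> ev k = Return i y \<and> start k i = a"
              using 1 True advance(2) \<open>a \<noteq> k\<close> Suc.prems by simp
            then show ?thesis by blast
          qed
        qed
      qed
    next
      case 2
      then show ?thesis using less_SucI by blast
    qed
  qed
qed simp

lemma return_once:
  assumes "ok m" "ev m = Return i y" "ok m'" "ev m' = Return i y'" "start m i = start m' i"
  shows "m = m'"
proof -
  have False if *: "ok m" "ev m = Return i y" "ok m'" "ev m' = Return i y'" "start m i = start m' i"
    "m < m'" for m m' y y'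
  proof -
    have i: "act m = i" "act m' = i" using * event_of_act by blast+
    from *(1) have "ctrl (st (Suc m) i) = Idle \<and> start (Suc m) i = start m i"
    proof (cases rule: act_cases)
      case (advance res)
      then have "res = Some y" using * i by (auto split: option.splits)
      with advance(1) show ?thesis using i advance(4) by cases auto
    qed (use * in auto)
    moreover have "start m i \<le> m" by (rule start_le)
    \<comment> \<open>Starting from \<open>Idle\<close>, the bound holds for every \<open>r\<close>,
      so a tag at \<open>m'\<close> would have to exceed itself.\<close>
    ultimately have idle: "ctrl (st m' i) = Idle \<or> (\<exists>r'\<ge>r. tag_of (ctrl (st m' i)) = Some r')" for r
      using * by (intro tag_mono[of "Suc m" m' i r]) auto
    from *(3) have "\<exists>r. tag_of (ctrl (st m' i)) = Some r"
    proof (cases rule: act_cases)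
      case (advance res)
      then have "res = Some y'" using * i by (auto split: option.splits)
      with advance(1) show ?thesis using i by cases auto
    qed (use * in auto)
    then obtain r where "tag_of (ctrl (st m' i)) = Some r" by blast
    then show False using idle[of "Suc r"] by auto
  qed
  then show ?thesis using assms by (metis linorder_neqE_nat)
qed

text \<open>The response \<open>Ack\<close> does not reveal the view behind it, so \<open>W\<close>
  is attached to the operation explicitly.\<close>

definition result :: "nat \<Rightarrow> nat \<Rightarrow> ('n, 'v) response \<Rightarrow> ('n, 'v) stamped set \<Rightarrow> bool" where
  "result a m y W \<longleftrightarrow> (\<exists>i op k j t. ok m \<and> ev m = Return i y \<and> start m i = a \<and> a < m \<and> ok a \<and>
     ev a = Invoke i op \<and> y = respond init op W \<and> k \<le> m \<and> good k j t W \<and>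
     (\<forall>k' j' t' W'. good k' j' t' W' \<longrightarrow> k' \<le> a \<longrightarrow> W' \<subseteq> W) \<and>
     (\<forall>v. op = Update v \<longrightarrow> (\<exists>x. stamped a x \<and> x \<in> W)))"

lemma result_exists:
  assumes "ok m" "ev m = Return i y"
  shows "\<exists>W. result (start m i) m y W"
proof (rule completed_view[OF assms])
  fix op W k j t
  assume "start m i < m" "ok (start m i)" "ev (start m i) = Invoke i op" "y = respond init op W" "k \<le> m"
    "good k j t W" "\<And>k' j' t' W'. good k' j' t' W' \<Longrightarrow> k' \<le> start m i \<Longrightarrow> W' \<subseteq> W"
    "\<And>v. op = Update v \<Longrightarrow> \<exists>x. stamped (start m i) x \<and> x \<in> W"
  then have "result (start m i) m y W"
    unfolding result_def using assms by blast
  then show ?thesis by blast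
qed

lemma result_once: "result a m y W \<Longrightarrow> result a m' y' W' \<Longrightarrow> m = m' \<and> y = y'"
  unfolding result_def using return_once by (metis event.inject(1) event.inject(2))

lemma result_good: "result a m y W \<Longrightarrow> \<exists>k j t. k \<le> m \<and> good k j t W"
  unfolding result_def by blast

lemma result_later:
  assumes "result a m y W" "result b m' y' W'" "m < b"
  shows "W \<subseteq> W'"
  using assms result_good unfolding result_def by (meson less_imp_le order.trans)

lemma stamped_op:
  assumes "stamped a (v, t, i)"
  shows "ok a" "ev a = Invoke i (Update v)"
  using assms stamping_update unfolding stamped_def by fastforce+

text \<open>The timestamp of \<open>x\<close> exceeds every tag written before \<open>b\<close> and
  is at most the tag of \<open>W'\<close>. So \<open>W'\<close> has a larger tag than
  \<open>W\<close>.\<close>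

lemma result_stamped:
  assumes "result a m y W" "m < b" "stamped b x" "good k j t W'" "x \<in> W'"
  shows "W \<subseteq> W'"
proof -
  obtain k' j' t' where g: "k' \<le> m" "good k' j' t' W" using result_good assms(1) by blast
  obtain v u i where x: "x = (v, u, i)" by (cases x)
  have "written b t'" using written_mono[OF good_written[OF g(2)]] g(1) assms(2) by simp
  then have "t' < u" using stamped_lower_bound assms(3) x by simp
  also have "u \<le> t" using good_mono assms(4,5) x by blast
  finally show ?thesis using good_larger_tag[OF g(2) assms(4)] by blast
qed

lemma update_in_result:
  assumes "result a m y W" "stamped a x"
  shows "x \<in> W"
proof -
  obtain v t i where "x = (v, t, i)" by (cases x)
  then have "ev a = Invoke i (Update v)" using stamped_op(2) assms(2) by blast
  then obtain x' where "stamped a x'" "x' \<in> W"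
    using assms(1) unfolding result_def by auto
  then show ?thesis using stamped_unique assms(2) by blast
qed

lemma completed_before_next:
  assumes "ok a" "ev a = Invoke i op" "ok b" "ev b = Invoke i op'" "a < b"
  obtains m y W where "result a m y W" "m < b"
proof -
  have "act b = i" using assms event_of_act by blast
  from assms(3) have "ctrl (st b i) = Idle"
    by (cases rule: act_cases) (use \<open>act b = i\<close> assms(4) in \<open>auto split: option.splits\<close>)
  then obtain m y where "m < b" "ok m" "ev m = Return i y" "start m i = a"
    using op_pending[OF assms(1,2,5)] by blast
  then show thesis using result_exists that by blast
qed

text \<open>UPDATEs of one node do not overlap: the first has its value in a view whose tag is
  written to a quorum before the second is invoked.\<close>

lemma stamped_order:
  assumes "stamped a (v, t, i)" "stamped b (v', t', i)" "a < b"
  shows "t < t'"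
proof -
  obtain m y W where m: "result a m y W" "m < b"
    using completed_before_next[OF stamped_op[OF assms(1)] stamped_op[OF assms(2)] assms(3)] by blast
  obtain k j u where u: "k \<le> m" "good k j u W" using result_good m by blast
  have "t \<le> u" using good_mono[OF u(2)] update_in_result[OF m(1) assms(1)] by blast
  also have "u < t'"
    using stamped_lower_bound[OF assms(2)] written_mono[OF good_written[OF u(2)]] u(1) m(2) by simp
  finally show ?thesis .
qed

lemma stamped_by_one:
  assumes "stamped a (v, t, i)" "stamped b (v', t, i)"
  shows "a = b"
  using assms stamped_order less_irrefl by (metis linorder_neqE_nat)

lemma good_stamped_op:
  assumes "good k j r W" "x \<in> W"
  obtains a where "stamped a x" "a < k"
proof -
  obtain t where t: "t < k" "stamping t x" using good_stamped[OF assms] by blast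
  then show thesis using that[of "start t (act t)"] stamping_update[OF t(2)]
    unfolding stamped_def by auto
qed

lemma stamped_after:
  assumes "result a m y W" "m < b" "stamped b x"
  shows "x \<notin> W"
proof
  assume "x \<in> W"
  obtain k j t where k: "k \<le> m" "good k j t W" using result_good assms(1) by blast
  obtain c where "stamped c x" "c < k" using good_stamped_op[OF k(2) \<open>x \<in> W\<close>] by blast
  moreover have "c = b"
    using stamped_by_one \<open>stamped c x\<close> assms(3) by (metis surj_pair)
  ultimately show False using k(1) assms(2) by simp
qed

lemma good_finite:
  assumes "good k i r W"
  shows "finite W"
proof -
  have "W \<subseteq> set (mcast k i)"
    using assms V_mcast[of k i i] tag_le_subset[of r "V (st k i) i"] unfolding good_def by blast
  then show ?thesis by (rule finite_subset) simp
qed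

lemma result_finite: "result a m y W \<Longrightarrow> finite W"
  using result_good[of a m y W] good_finite by blast

lemma result_chain: "result a m y W \<Longrightarrow> result a' m' y' W' \<Longrightarrow> W \<subseteq> W' \<or> W' \<subseteq> W"
  using result_good[of a m y W] result_good[of a' m' y' W'] good_chain by blast

text \<open>
  The rank \<open>\<infinity>\<close>, of the infimum of the empty set, is that of pending SCANs and of UPDATEs that no
  completed SCAN sees.
\<close>

definition view :: "nat \<Rightarrow> ('n, 'v) stamped set" where
  "view a = (SOME W. \<exists>m y. result a m y W)"

definition completed_scans :: "nat set" where
  "completed_scans = {a. (\<exists>i. ev a = Invoke i Scan) \<and> (\<exists>m y W. result a m y W)}"

text \<open>The views of completed SCANs are finite and form a chain, so cardinality orders them as
  inclusion does. An UPDATE shares the rank of the smallest view that contains its value.\<close>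

definition rank :: "nat \<Rightarrow> enat" where
  "rank a = (if a \<in> completed_scans then enat (card (view a))
     else INF b \<in> {b \<in> completed_scans. \<exists>x \<in> view b. stamped a x}. enat (card (view b)))"

text \<open>Within one rank, UPDATEs come before SCANs, and ties are broken by the position of the
  invocation, which agrees with real time and makes \<open>key\<close> injective.\<close>

definition key :: "nat \<Rightarrow> enat \<times> nat \<times> nat" where
  "key a = (rank a, if \<exists>i. ev a = Invoke i Scan then 1 else 0, a)"

lemma result_view: "result a m y W \<Longrightarrow> result a m y (view a)"
  unfolding view_def by (rule someI2_ex[where P = "\<lambda>W. \<exists>m y. result a m y W"]) (use result_once in blast)+

lemma completed_scanE:
  assumes "b \<in> completed_scans"
  obtains m y where "result b m y (view b)"
  using assms result_view unfolding completed_scans_def by blast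

lemma stamped_not_scan: "stamped a x \<Longrightarrow> a \<notin> completed_scans"
  using stamped_op(2) unfolding completed_scans_def by (cases x) fastforce

lemma rank_stamped:
  assumes "stamped a x"
  shows "rank a = (INF b \<in> {b \<in> completed_scans. x \<in> view b}. enat (card (view b)))"
proof -
  have "{b \<in> completed_scans. \<exists>x \<in> view b. stamped a x} = {b \<in> completed_scans. x \<in> view b}"
    using assms stamped_unique by blast
  then show ?thesis unfolding rank_def using stamped_not_scan[OF assms] by simp
qed

lemma rank_unstamped:
  assumes "a \<notin> completed_scans" "\<nexists>x. stamped a x"
  shows "rank a = \<infinity>"
proof -
  have "{b \<in> completed_scans. \<exists>x \<in> view b. stamped a x} = {}" using assms(2) by blast
  then show ?thesis
    unfolding rank_def using assms(1) by (simp only: if_False image_empty Inf_empty top_enat_def)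
qed

lemma rank_le_scan:
  assumes "b \<in> completed_scans" "stamped a x"
  shows "rank a \<le> rank b \<longleftrightarrow> x \<in> view b"
proof
  assume "x \<in> view b"
  then have "rank a \<le> enat (card (view b))"
    unfolding rank_stamped[OF assms(2)] using assms(1) by (intro INF_lower) simp
  then show "rank a \<le> rank b" using assms(1) by (simp add: rank_def)
next
  assume *: "rank a \<le> rank b"
  show "x \<in> view b"
  proof (rule ccontr)
    assume "x \<notin> view b"
    \<comment> \<open>The successor keeps the inequality strict under the infimum, also if no
      completed SCAN sees \<open>x\<close> and the infimum is infinite.\<close>
    have "enat (Suc (card (view b))) \<le> enat (card (view c))"
      if c: "c \<in> completed_scans" "x \<in> view c" for c
    proof -
      obtain m y m' y' where "result b m y (view b)" "result c m' y' (view c)"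
        using completed_scanE assms(1) c(1) by metis
      then have "finite (view c)" "view b \<subset> view c"
        using result_finite result_chain \<open>x \<notin> view b\<close> c(2) by blast+
      then show ?thesis by (simp add: Suc_le_eq psubset_card_mono)
    qed
    then have "enat (Suc (card (view b))) \<le> rank a"
      unfolding rank_stamped[OF assms(2)] by (intro INF_greatest) blast
    also note *
    also have "rank b = enat (card (view b))" using assms(1) by (simp add: rank_def)
    finally show False by simp
  qed
qed

lemma key_le_scan:
  assumes "b \<in> completed_scans" "stamped a x"
  shows "key a \<le> key b \<longleftrightarrow> x \<in> view b"
proof -
  obtain i where i: "ev b = Invoke i Scan"
    using assms(1) unfolding completed_scans_def by blast
  have "\<nexists>i. ev a = Invoke i Scan" using stamped_op(2) assms(2) by (cases x) fastforce
  then have "key a \<le> key b \<longleftrightarrow> rank a \<le> rank b"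
    unfolding key_def using i by (auto simp: less_eq_prod_def)
  then show ?thesis using rank_le_scan[OF assms] by simp
qed

text \<open>A SCAN followed by a stamped UPDATE needs a strict inequality of ranks, since a tie
  would put the UPDATE first; the view of the SCAN cannot contain the later value. After an UPDATE a
  weak inequality is enough: every SCAN that sees a later value also sees the earlier one, by
  \<open>result_stamped\<close>.\<close>

lemma key_real_time:
  assumes "result a m y W" "m < b" "ok b" "ev b = Invoke i op"
  shows "key a < key b"
proof -
  have "a < b" using assms(1,2) unfolding result_def by auto
  have a: "result a m y (view a)" using assms(1) by (rule result_view)
  obtain j op' where ev_a: "ev a = Invoke j op'" using assms(1) unfolding result_def by blast
  have later: "view a \<subseteq> view b" if "b \<in> completed_scans"
    using that result_later[OF a _ assms(2)] by (rule completed_scanE)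
  have not_scan: "x \<notin> view a" if "stamped b x" for x
    using stamped_after[OF a assms(2) that] .
  show ?thesis
  proof (cases op')
    case Scan
    then have scan: "a \<in> completed_scans"
      unfolding completed_scans_def using ev_a assms(1) by blast
    then have rank: "rank a = enat (card (view a))" by (simp add: rank_def)
    consider "b \<in> completed_scans" | x where "stamped b x" | "rank b = \<infinity>"
      using rank_unstamped[of b] by metis
    then show ?thesis
    proof cases
      case 1
      then obtain i where "ev b = Invoke i Scan" unfolding completed_scans_def by blast
      moreover have "rank a \<le> rank b"
      proof -
        obtain m' y' where "result b m' y' (view b)" using 1 by (rule completed_scanE)
        then have "card (view a) \<le> card (view b)"
          using result_finite later[OF 1] card_mono by blast
        then show ?thesis using 1 rank by (simp add: rank_def)
      qed
      ultimately show ?thesis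
        unfolding key_def using \<open>a < b\<close> ev_a Scan by (auto simp: less_prod_def)
    next
      case 2
      then have "rank a < rank b" using rank_le_scan[OF scan] not_scan by (meson not_le)
      then show ?thesis unfolding key_def by (simp add: less_prod_def)
    next
      case 3
      then show ?thesis unfolding key_def using rank by (simp add: less_prod_def)
    qed
  next
    case (Update v)
    then obtain x where x: "stamped a x" "x \<in> view a"
      using a ev_a unfolding result_def by auto
    have no_scan: "\<nexists>i. ev a = Invoke i Scan" using ev_a Update by simp
    have "rank a \<le> rank b"
    proof -
      consider "b \<in> completed_scans" | x' where "stamped b x'" | "rank b = \<infinity>"
        using rank_unstamped[of b] by metis
      then show ?thesis
      proof cases
        case 1
        then show ?thesis using rank_le_scan x later by blast
      next
        case 2
        have "x \<in> view c" if c: "c \<in> completed_scans" "x' \<in> view c" for c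
        proof -
          obtain m' y' where "result c m' y' (view c)" using c(1) by (rule completed_scanE)
          then obtain k j t where "good k j t (view c)" using result_good by blast
          then show ?thesis using result_stamped[OF a assms(2) 2 _ c(2)] x(2) by blast
        qed
        then show ?thesis
          unfolding rank_stamped[OF x(1)] rank_stamped[OF 2] by (intro INF_superset_mono) auto
      next
        case 3
        then show ?thesis by simp
      qed
    qed
    then show ?thesis
      unfolding key_def using \<open>a < b\<close> no_scan by (auto simp: less_prod_def)
  qed
qed

section \<open>The linear order and its sequential specification\<close>

definition linearization :: "nat rel" where
  "linearization = {(a, b). ok a \<and> (\<exists>i op. ev a = Invoke i op) \<and>
     ok b \<and> (\<exists>i op. ev b = Invoke i op) \<and> key a \<le> key b}"

text \<open>The order is pulled back along an injection into a lexicographic product of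
  \<open>enat\<close> and \<open>nat\<close>, which is well-ordered.\<close>

lemma well_order_linearization: "well_order_on {a. ok a \<and> (\<exists>i op. ev a = Invoke i op)} linearization"
proof -
  have inj: "key a = key b \<Longrightarrow> a = b" for a b by (simp add: key_def)
  have "linearization - Id \<subseteq> inv_image {(x, y). x < y} key"
    using inj unfolding linearization_def by (auto simp: order.order_iff_strict)
  then have "wf (linearization - Id)"
    by (rule wf_subset[rotated]) (intro wf_inv_image wf)
  then show ?thesis
    unfolding well_order_on_def linear_order_on_def partial_order_on_def preorder_on_def
      refl_on_def trans_def antisym_def total_on_def
    using inj by (auto simp: linearization_def intro: order.antisym order.trans)
qed

text \<open>A timestamp belongs to a single UPDATE and hence to a single value, so the definite
  description in \<open>snapshot\<close> is proper.\<close>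

lemma snapshot_in:
  assumes "good k j r W" "(v, t, i) \<in> W" "\<And>v' t'. (v', t', i) \<in> W \<Longrightarrow> t' \<le> t"
  shows "snapshot init W i = v"
proof -
  have "v' = v" if v': "(v', t', i) \<in> W" "\<And>v'' t''. (v'', t'', i) \<in> W \<Longrightarrow> t'' \<le> t'" for v' t'
  proof -
    have "t' = t" using v' assms(2,3) by (meson order.antisym)
    obtain a where a: "stamped a (v, t, i)" using good_stamped_op[OF assms(1,2)] by blast
    obtain b where b: "stamped b (v', t', i)" using good_stamped_op[OF assms(1) v'(1)] by blast
    have "a = b" using stamped_by_one a b \<open>t' = t\<close> by blast
    then show "v' = v" using stamped_unique a b by blast
  qed
  then have "(THE v. \<exists>t. (v, t, i) \<in> W \<and> (\<forall>v' t'. (v', t', i) \<in> W \<longrightarrow> t' \<le> t)) = v"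
    using assms(2,3) by (intro the_equality) blast+
  then show ?thesis using assms(2) unfolding snapshot_def by auto
qed

lemma snapshot_latest:
  assumes "result b m y W" "ev b = Invoke j Scan"
  defines "U \<equiv> \<lambda>i. {a. (a, b) \<in> linearization \<and> (\<exists>v. ev a = Invoke i (Update v))}"
  obtains snp where "y = Snap snp" "\<And>i. U i = {} \<Longrightarrow> snp i = init i"
    "\<And>i. U i \<noteq> {} \<Longrightarrow> \<exists>a\<in>U i. (\<forall>c\<in>U i. (c, a) \<in> linearization) \<and> ev a = Invoke i (Update (snp i))"
proof -
  have scan: "b \<in> completed_scans" unfolding completed_scans_def using assms by blast
  have b: "result b m y (view b)" using assms(1) by (rule result_view)
  obtain k l r where good: "good k l r (view b)" using result_good[OF b] by blast
  have y: "y = Snap (snapshot init (view b))"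
    using b assms(2) unfolding result_def by auto
  have ok_b: "ok b"
    using b unfolding result_def by blast
  have U: "a \<in> U i \<longleftrightarrow> (\<exists>v t. stamped a (v, t, i) \<and> (v, t, i) \<in> view b)" for a i
  proof
    assume "a \<in> U i"
    then obtain v where a: "ok a" "ev a = Invoke i (Update v)" "key a \<le> key b"
      unfolding U_def linearization_def by blast
    \<comment> \<open>A finite rank of \<open>b\<close> excludes UPDATEs that never got a timestamp,
      because these have rank \<open>\<infinity>\<close>.\<close>
    have "rank b \<noteq> \<infinity>" using scan by (simp add: rank_def)
    moreover have "rank a \<le> rank b" using a(3) unfolding key_def by (auto simp: less_eq_prod_def)
    moreover have "a \<notin> completed_scans" using a(2) unfolding completed_scans_def by simp
    ultimately obtain x where x: "stamped a x"
      using rank_unstamped[of a] by (metis enat_ord_simps(5))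
    obtain v' t' i' where x': "x = (v', t', i')" by (cases x)
    then have "i' = i" using stamped_op(2) x a(2) by fastforce
    then show "\<exists>v t. stamped a (v, t, i) \<and> (v, t, i) \<in> view b"
      using x x' a(3) key_le_scan[OF scan x] by blast
  next
    assume "\<exists>v t. stamped a (v, t, i) \<and> (v, t, i) \<in> view b"
    then obtain v t where a: "stamped a (v, t, i)" "(v, t, i) \<in> view b" by blast
    then show "a \<in> U i"
      unfolding U_def linearization_def
      using key_le_scan[OF scan a(1)] stamped_op[OF a(1)] ok_b assms(2) by blast
  qed
  show thesis
  proof (rule that[OF y])
    fix i
    assume "U i = {}"
    then have "(v, t, i) \<notin> view b" for v t
      using good_stamped_op[OF good] U by (metis empty_iff)
    then show "snapshot init (view b) i = init i" unfolding snapshot_def by simp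
  next
    fix i
    assume "U i \<noteq> {}"
    define T where "T = {t. \<exists>v. (v, t, i) \<in> view b}"
    have "finite T"
      using good_finite[OF good] unfolding T_def
      by (rule finite_surj[where f = "fst \<circ> snd"]) force
    moreover have "T \<noteq> {}" using \<open>U i \<noteq> {}\<close> U unfolding T_def by blast
    ultimately have "Max T \<in> T" "\<And>t. t \<in> T \<Longrightarrow> t \<le> Max T" by auto
    then obtain v t where v: "(v, t, i) \<in> view b" "\<And>v' t'. (v', t', i) \<in> view b \<Longrightarrow> t' \<le> t"
      unfolding T_def by blast
    then have snp: "snapshot init (view b) i = v" using snapshot_in[OF good] by blast
    obtain a where a: "stamped a (v, t, i)" using good_stamped_op[OF good v(1)] by blast
    have "(c, a) \<in> linearization" if "c \<in> U i" for c
    proof -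
      from that obtain v' t' where c: "stamped c (v', t', i)" "(v', t', i) \<in> view b" using U by blast
      then have "\<not> a < c" using stamped_order[OF a] v(2) by (meson leD)
      then have "key c \<le> key a"
        using completed_before_next[OF stamped_op[OF c(1)] stamped_op[OF a]]
          key_real_time[OF _ _ stamped_op[OF a]]
        by (metis linorder_neqE_nat order.refl order.strict_implies_order)
      then show ?thesis unfolding linearization_def using stamped_op[OF a] stamped_op[OF c(1)] by blast
    qed
    then show "\<exists>a\<in>U i. (\<forall>c\<in>U i. (c, a) \<in> linearization) \<and>
      ev a = Invoke i (Update (snapshot init (view b) i))"
      using U a v(1) snp stamped_op[OF a] by blast
  qed
qed

end

section \<open>From executions to runs\<close>

lemma step_annotated:
  assumes "step f init C e C'"
  obtains (ok) i s' ch outs where "\<And>j. e \<noteq> Crash j" "i \<notin> crashed C" "node_step f init C i e s' ch outs"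
      "C' = C\<lparr>nodes := (nodes C)(i := s'), chan := post i outs ch\<rparr>"
  | (crash) i outs where "e = Crash i" "nodes C' = nodes C" "crashed C \<subseteq> crashed C'"
      "\<And>j l. l \<notin> crashed C' \<Longrightarrow> chan C' j l = chan C j l @ (if j = i then msgs l outs else [])"
      "outs \<noteq> [] \<Longrightarrow> i \<notin> crashed C \<and> i \<in> crashed C' \<and>
         (\<exists>e' s' ch outs'. node_step f init C i e' s' ch outs' \<and> interrupted outs' outs)"
  using assms
proof cases
  case (normal i s' ch outs)
  then have "e \<noteq> Crash j" for j by (auto elim: node_step.cases)
  then show ?thesis using normal ok by blast
next
  case (crash i)
  then show ?thesis by (intro that(2)[of i "[]"]) auto
next
  case (crash_sending i e' s' ch outs outs')
  \<comment> \<open>An interrupted delivery changes only a channel into the crashing node, so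
    channels to nodes that stay alive are merely extended.\<close>
  have "ch j l = chan C j l" if "l \<noteq> i" for j l
    using crash_sending(5) that by cases auto
  then show ?thesis
    using crash_sending by (intro that(2)[of i outs']) (auto simp: post_apply)
qed

theorem theorem28:
  fixes f :: nat
    and init :: "'n::finite \<Rightarrow> 'v"
    and N :: enat
    and C :: "nat \<Rightarrow> ('n, 'v) config"
    and ev :: "nat \<Rightarrow> ('n, 'v) event"
  assumes "2 * f < CARD('n)"
    and "execution f init N C ev"
  shows "\<exists>\<sigma>. well_order_on (operations N ev) \<sigma> \<and>
             real_time_order N ev \<sigma> \<and>
             sequential_spec init N ev \<sigma>"
proof -
  \<comment> \<open>If \<open>k\<close> exceeds \<open>N\<close>, then \<open>N\<close> is finite
    and \<open>C'\<close> stays at the last configuration.\<close>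
  define lim where "lim k = (if enat k \<le> N then k else the_enat N)" for k
  have lim: "lim k = k \<and> lim (Suc k) = Suc k" if "enat k < N" for k
    using that unfolding lim_def by (simp add: Suc_ile_eq less_imp_le)
  have lim': "lim (Suc k) = lim k" if "\<not> enat k < N" for k
    using that unfolding lim_def by (cases N) auto
  define C' where "C' k = C (lim k)" for k
  define P where "P k i outs b \<longleftrightarrow>
      (b \<longrightarrow> enat k < N \<and> (\<forall>j. ev k \<noteq> Crash j) \<and> i \<notin> crashed (C' k) \<and>
      (\<exists>s' ch. node_step f init (C' k) i (ev k) s' ch outs \<and>
         C' (Suc k) = (C' k)\<lparr>nodes := (nodes (C' k))(i := s'), chan := post i outs ch\<rparr>)) \<and>
      (\<not> b \<longrightarrow> (enat k < N \<longrightarrow> (\<exists>j. ev k = Crash j)) \<and>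
      nodes (C' (Suc k)) = nodes (C' k) \<and> crashed (C' k) \<subseteq> crashed (C' (Suc k)) \<and>
      (\<forall>j l. l \<notin> crashed (C' (Suc k)) \<longrightarrow>
         chan (C' (Suc k)) j l = chan (C' k) j l @ (if j = i then msgs l outs else [])) \<and>
      (outs \<noteq> [] \<longrightarrow> i \<notin> crashed (C' k) \<and> i \<in> crashed (C' (Suc k)) \<and>
         (\<exists>e s' ch outs'. node_step f init (C' k) i e s' ch outs' \<and> interrupted outs' outs)))"
    for k i outs b
  have "\<exists>i outs b. P k i outs b" for k
  proof (cases "enat k < N")
    case True
    then have "step f init (C' k) (ev k) (C' (Suc k))"
      using assms(2) lim unfolding execution_def C'_def by simp
    then show ?thesis
    proof (cases rule: step_annotated)
      case (ok i s' ch outs)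
      then have "P k i outs True" unfolding P_def using True by blast
      then show ?thesis by blast
    next
      case (crash i outs)
      then have "P k i outs False" unfolding P_def by blast
      then show ?thesis by blast
    qed
  next
    case False
    then have "P k undefined [] False" unfolding P_def C'_def by (simp add: lim')
    then show ?thesis by blast
  qed
  then obtain act out ok where P: "\<And>k. P k (act k) (out k) (ok k)" by metis
  \<comment> \<open>From position \<open>N\<close> on, \<open>ev\<close> is arbitrary and may
    contain spurious invocations, which \<open>ok\<close> filters out.\<close>
  have ok: "ok k \<longleftrightarrow> enat k < N \<and> (\<forall>j. ev k \<noteq> Crash j)" for k
    using P[of k] unfolding P_def by blast
  interpret run f init C' ev act out ok
  proof
    show "2 * f < CARD('n)" by fact
    show "C' 0 = init_config"
      using assms(2) unfolding execution_def C'_def lim_def by (simp add: zero_enat_def[symmetric])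
  qed (use P in \<open>unfold P_def, blast+\<close>)
  have ops: "operations N ev = {a. ok a \<and> (\<exists>i op. ev a = Invoke i op)}"
    unfolding operations_def by (auto simp: ok)
  have result: "\<exists>W. result a m x W" if "completes N ev a m x" for a m x
  proof -
    from that obtain i op where i: "a < m" "enat m < N" "ev a = Invoke i op" "ev m = Return i x"
      "\<And>l y. a < l \<Longrightarrow> l < m \<Longrightarrow> ev l \<noteq> Return i y"
      unfolding completes_def by blast
    moreover from i have "enat a < N" by (meson enat_ord_simps(2) order.strict_trans)
    ultimately have "ok a" "ok m" by (auto simp: ok)
    then have "start m i = a" using op_pending[of a i op m] i by blast
    then show ?thesis using result_exists[OF \<open>ok m\<close> i(4)] by simp
  qed
  have "well_order_on (operations N ev) linearization"
    unfolding ops by (rule well_order_linearization)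
  moreover have "real_time_order N ev linearization"
    unfolding real_time_order_def
  proof (intro ballI impI)
    fix a b
    assume ab: "a \<in> operations N ev" "b \<in> operations N ev" "\<exists>m x. completes N ev a m x \<and> m < b"
    then obtain m x W where "result a m x W" "m < b" using result by blast
    then have "key a < key b" using key_real_time ab(2) unfolding ops by blast
    then show "(a, b) \<in> linearization \<and> a \<noteq> b"
      using ab(1,2) unfolding linearization_def ops by auto
  qed
  moreover have "sequential_spec init N ev linearization"
    unfolding sequential_spec_def
  proof (intro ballI allI impI)
    fix b j m x
    assume b: "b \<in> operations N ev" "ev b = Invoke j Scan \<and> completes N ev b m x"
    then obtain W where "result b m x W" using result by blast
    moreover have U: "updates_before N ev linearization i b =
      {a. (a, b) \<in> linearization \<and> (\<exists>v. ev a = Invoke i (Update v))}" for i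
      unfolding updates_before_def ops using b(2) by (auto simp: linearization_def)
    ultimately show "\<exists>snp. x = Snap snp \<and>
          (\<forall>i. if updates_before N ev linearization i b = {} then snp i = init i
               else \<exists>a\<in>updates_before N ev linearization i b.
                      (\<forall>c\<in>updates_before N ev linearization i b. (c, a) \<in> linearization) \<and>
                      ev a = Invoke i (Update (snp i)))"
      using b(2) unfolding U by (elim snapshot_latest) auto
  qed
  ultimately show ?thesis by blast
qed

end
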